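(* Let $(X_j,Y_j)_{j\ge 1}$ be i.i.d. real random pairs with continuous marginal distribution functions and copula $C$, where $C$ has continuous partial derivatives. Let $\alpha\in(0,1)$ and $i(n)=\alpha n$. Then the mean squared error of the nonparametric estimator $\widehat\lambda_{L,n}(i(n)/n)=\widehat C_n(\alpha,\alpha)/\alpha$ of the lower tail dependence coefficient $\lambda_L$ behaves asymptotically in the following manner: $$\mathbb{E}\left[\left(\widehat \lambda_{L,n}\left(\frac{i(n)}{n}\right)-\lambda_L\right)^2\right] = V_{L,n}(\alpha) + \left(\frac{1}{\alpha}\delta(\alpha)-\delta'(0)\right)^2,$$ where $$\lim_{n\to\infty} n\,V_{L,n}(\alpha)=\frac{\sigma^2(\alpha)}{\alpha^2}$$ and $$\sigma^2(\alpha)=\delta(\alpha)(1-\delta(\alpha)) +(1-\alpha)\left[\alpha\left(h_1(\alpha)^2+h_2(\alpha)^2\right)- 2 \delta(\alpha)\left(h_1(\alpha)+h_2(\alpha)\right)\right] + 2 h_1(\alpha)h_2(\alpha)\left(\delta(\alpha)-\alpha^2\right).$$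
   Context: The copula $C$ of a pair $(X,Y)$ with continuous marginal distribution functions $F_X,F_Y$ and joint distribution function $F$ is the function on $[0,1]^2$ with $F(x,y)=C(F_X(x),F_Y(y))$. The lower tail dependence coefficient is $\lambda_L=\lim_{u\to0^+}C(u,u)/u$ (assumed to exist). The diagonal section of $C$ is $\delta(u)=C(u,u)$; $\delta'(0)$ is its (right) derivative at $0$, so that $\lambda_L=\delta'(0)$. The h-functions are $h_1(u,v)=\partial C(u,v)/\partial u$ and $h_2(u,v)=\partial C(u,v)/\partial v$, and one writes $h_1(u)=h_1(u,u)$, $h_2(u)=h_2(u,u)$. Given $n$ observations $(X_j,Y_j)$, $1\le j\le n$, the empirical marginal distribution functions are $\widehat F_{X,n}(x)=\frac1n\sum_{j=1}^n \mathbf 1\{X_j\le x\}$ and $\widehat F_{Y,n}(y)=\frac1n\sum_{j=1}^n \mathbf 1\{Y_j\le y\}$, and the empirical copula is $$\widehat C_n(u,v)=\frac1n\sum_{j=1}^n \mathbf 1\{\widehat F_{X,n}(X_j)\le u\}\,\mathbf 1\{\widehat F_{Y,n}(Y_j)\le v\}.$$ The nonparametric estimator of the lower tail dependence coefficient with threshold $i$ is $$\widehat\lambda_{L,n}\left(\frac in\right)=\frac{\widehat C_n\left(\frac in,\frac in\right)}{\frac in}.$$ With $i=i(n)=\alpha n$ this formula is evaluated at $i(n)/n=\alpha$.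
   Formalization: The displayed equality fails as an exact identity (independence copula, α=1/2, odd n). Proved instead: with V the variance of the estimator, the MSE is V plus the square of δ(α)/α − δ'(0) + r_n, where r_n = o(n^{-1/2}); the limit of nV is as stated. *)

theory Defs
  imports "HOL-Probability.Probability" "HOL-Library.Landau_Symbols"
begin

definition copula :: "(real \<Rightarrow> real \<Rightarrow> real) \<Rightarrow> bool" where
  "copula C \<longleftrightarrow>
     (\<forall>u\<in>{0..1}. C u 0 = 0 \<and> C 0 u = 0 \<and> C u 1 = u \<and> C 1 u = u) \<and>
     (\<forall>u\<^sub>1 u\<^sub>2 v\<^sub>1 v\<^sub>2. 0 \<le> u\<^sub>1 \<and> u\<^sub>1 \<le> u\<^sub>2 \<and> u\<^sub>2 \<le> 1 \<and> 0 \<le> v\<^sub>1 \<and> v\<^sub>1 \<le> v\<^sub>2 \<and> v\<^sub>2 \<le> 1 \<longrightarrow>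
        0 \<le> C u\<^sub>2 v\<^sub>2 - C u\<^sub>2 v\<^sub>1 - C u\<^sub>1 v\<^sub>2 + C u\<^sub>1 v\<^sub>1)"

definition joint_cdf :: "'a measure \<Rightarrow> ('a \<Rightarrow> real) \<Rightarrow> ('a \<Rightarrow> real) \<Rightarrow> real \<Rightarrow> real \<Rightarrow> real" where
  "joint_cdf M X Y x y = measure M {\<omega> \<in> space M. X \<omega> \<le> x \<and> Y \<omega> \<le> y}"

text \<open>The values of a copula outside the unit square are irrelevant and left unconstrained.\<close>

definition copula_of ::
  "'a measure \<Rightarrow> ('a \<Rightarrow> real) \<Rightarrow> ('a \<Rightarrow> real) \<Rightarrow> (real \<Rightarrow> real \<Rightarrow> real) \<Rightarrow> bool" where
  "copula_of M X Y C \<longleftrightarrow> copula C \<and>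
     (\<forall>x y. joint_cdf M X Y x y = C (cdf (distr M borel X) x) (cdf (distr M borel Y) y))"

definition h1 :: "(real \<Rightarrow> real \<Rightarrow> real) \<Rightarrow> real \<Rightarrow> real \<Rightarrow> real" where
  "h1 C u v = deriv (\<lambda>s. C s v) u"

definition h2 :: "(real \<Rightarrow> real \<Rightarrow> real) \<Rightarrow> real \<Rightarrow> real \<Rightarrow> real" where
  "h2 C u v = deriv (\<lambda>t. C u t) v"

text \<open>
  The partial derivatives are required on the open unit square only. Existence and continuity
  up to the corner (0,0) would force the lower tail dependence coefficient to vanish, because
  C is zero on the axes.
\<close>

definition continuous_partials :: "(real \<Rightarrow> real \<Rightarrow> real) \<Rightarrow> bool" where
  "continuous_partials C \<longleftrightarrow>
     (\<forall>u\<in>{0<..<1}. \<forall>v\<in>{0<..<1}.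
        (\<lambda>s. C s v) differentiable (at u) \<and> (\<lambda>t. C u t) differentiable (at v)) \<and>
     continuous_on ({0<..<1} \<times> {0<..<1}) (\<lambda>(u, v). h1 C u v) \<and>
     continuous_on ({0<..<1} \<times> {0<..<1}) (\<lambda>(u, v). h2 C u v)"

definition diag_section :: "(real \<Rightarrow> real \<Rightarrow> real) \<Rightarrow> real \<Rightarrow> real" where
  "diag_section C u = C u u"

definition diag_deriv0 :: "(real \<Rightarrow> real \<Rightarrow> real) \<Rightarrow> real" where
  "diag_deriv0 C = vector_derivative (diag_section C) (at_right 0)"

definition lower_tail_dep :: "(real \<Rightarrow> real \<Rightarrow> real) \<Rightarrow> real" where
  "lower_tail_dep C = Lim (at_right 0) (\<lambda>u. C u u / u)"

text \<open>Empirical quantities of a sample x 1, ..., x n (paired with y 1, ..., y n).\<close>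

definition emp_cdf :: "nat \<Rightarrow> (nat \<Rightarrow> real) \<Rightarrow> real \<Rightarrow> real" where
  "emp_cdf n x t = (\<Sum>j=1..n. of_bool (x j \<le> t)) / real n"

definition emp_copula :: "nat \<Rightarrow> (nat \<Rightarrow> real) \<Rightarrow> (nat \<Rightarrow> real) \<Rightarrow> real \<Rightarrow> real \<Rightarrow> real" where
  "emp_copula n x y u v =
     (\<Sum>j=1..n. of_bool (emp_cdf n x (x j) \<le> u) * of_bool (emp_cdf n y (y j) \<le> v)) / real n"

definition ltd_estimate :: "nat \<Rightarrow> (nat \<Rightarrow> real) \<Rightarrow> (nat \<Rightarrow> real) \<Rightarrow> real \<Rightarrow> real" where
  "ltd_estimate n x y t = emp_copula n x y t t / t"

definition ltd_estimator ::
  "nat \<Rightarrow> (nat \<Rightarrow> 'a \<Rightarrow> real) \<Rightarrow> (nat \<Rightarrow> 'a \<Rightarrow> real) \<Rightarrow> real \<Rightarrow> 'a \<Rightarrow> real" where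
  "ltd_estimator n X Y t \<omega> = ltd_estimate n (\<lambda>j. X j \<omega>) (\<lambda>j. Y j \<omega>) t"

definition sigma_sq :: "(real \<Rightarrow> real \<Rightarrow> real) \<Rightarrow> real \<Rightarrow> real" where
  "sigma_sq C \<alpha> =
    (let \<delta> = diag_section C \<alpha>; a = h1 C \<alpha> \<alpha>; b = h2 C \<alpha> \<alpha> in
       \<delta> * (1 - \<delta>)
       + (1 - \<alpha>) * (\<alpha> * (a\<^sup>2 + b\<^sup>2) - 2 * \<delta> * (a + b))
       + 2 * a * b * (\<delta> - \<alpha>\<^sup>2))"

end

theory Submission
  imports Defs
begin

text \<open>
  Fix points with marginal distribution function values equal to \<open>\<alpha>\<close>. Write \<open>A\<close>, \<open>B\<close>, \<open>D\<close> for the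
  normalised empirical processes of the first margin, the second margin and the joint
  distribution function there. Then \<open>sqrt n * (C_n - \<delta>) = D - h1 * A - h2 * B + R_n\<close>, where \<open>C_n\<close> is
  the empirical copula at \<open>(\<alpha>, \<alpha>)\<close>, and the linear part is centred with variance \<open>\<sigma>\<^sup>2\<close>. So it
  suffices to show that \<open>R_n\<close> tends to 0 in mean square, which controls bias and variance alike.

  In probability: the empirical copula is monotone in its thresholds, so it is squeezed between
  values of the empirical joint distribution function at population quantiles
  \<open>\<alpha> + s / sqrt n\<close>, with \<open>s\<close> in a fixed finite grid close to \<open>- A\<close> (respectively \<open>- B\<close>). On the
  finite grid only Chebyshev's inequality and differentiability of the copula are needed.

  In mean square: without ties, \<open>C_n\<close> differs from the empirical joint distribution function by
  at most \<open>(\<bar>A\<bar> + \<bar>B\<bar>) / sqrt n + 2 / n\<close>, since sets of lowest ranks are nested. Hence \<open>R_n\<close> has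
  bounded fourth moments, and convergence in probability upgrades to mean square.
\<close>

section \<open>Moments and mean-square convergence\<close>

lemma (in prob_space) indep_var_bounded_integral_mult:
  fixes U V :: "'a \<Rightarrow> real" and f g :: "real \<Rightarrow> real"
  assumes "indep_var borel U borel V"
    and "f \<in> borel_measurable borel" "g \<in> borel_measurable borel"
    and "\<And>\<omega>. \<bar>f (U \<omega>)\<bar> \<le> b" "\<And>\<omega>. \<bar>g (V \<omega>)\<bar> \<le> c"
  shows "expectation (\<lambda>\<omega>. f (U \<omega>) * g (V \<omega>))
    = expectation (\<lambda>\<omega>. f (U \<omega>)) * expectation (\<lambda>\<omega>. g (V \<omega>))"
proof -
  have [measurable]: "U \<in> borel_measurable M" "V \<in> borel_measurable M"
    using assms(1) by (auto dest: indep_var_rv1 indep_var_rv2)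
  note [measurable] = assms(2,3)
  have "indep_var borel (f \<circ> U) borel (g \<circ> V)"
    using assms by (intro indep_var_compose) auto
  then have "indep_var borel (\<lambda>\<omega>. f (U \<omega>)) borel (\<lambda>\<omega>. g (V \<omega>))"
    by (simp add: comp_def)
  moreover have "integrable M (\<lambda>\<omega>. f (U \<omega>))"
    using assms(4) by (intro integrable_const_bound[of _ b]) auto
  moreover have "integrable M (\<lambda>\<omega>. g (V \<omega>))"
    using assms(5) by (intro integrable_const_bound[of _ c]) auto
  ultimately show ?thesis
    by (rule indep_var_lebesgue_integral)
qed

text \<open>Induction on \<open>n\<close>. The partial sum is independent of the next summand, so
  every mixed term of the binomial expansion factorises, and it vanishes as soon as one factor is a
  first power. In the fourth power, \<open>6 * S^2 * W^2\<close> is the only mixed term that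
  survives.\<close>

lemma (in prob_space) indep_sum_moments:
  fixes W :: "nat \<Rightarrow> 'a \<Rightarrow> real"
  assumes indep: "indep_vars (\<lambda>_. borel) W {1..}"
    and bound: "\<And>j \<omega>. \<bar>W j \<omega>\<bar> \<le> c"
    and mean: "\<And>j. j \<ge> 1 \<Longrightarrow> expectation (W j) = 0"
  shows "expectation (\<lambda>\<omega>. \<Sum>j=1..n. W j \<omega>) = 0"
    and "expectation (\<lambda>\<omega>. (\<Sum>j=1..n. W j \<omega>)\<^sup>2) = (\<Sum>j=1..n. expectation (\<lambda>\<omega>. (W j \<omega>)\<^sup>2))"
    and "expectation (\<lambda>\<omega>. (\<Sum>j=1..n. W j \<omega>) ^ 4) \<le> 3 * (real n)\<^sup>2 * c ^ 4"
proof -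
  have W[measurable]: "W j \<in> borel_measurable M" if "j \<ge> 1" for j
    using indep that by (auto simp: indep_vars_def)
  define S where "S = (\<lambda>n \<omega>. \<Sum>j=1..n. W j \<omega>)"
  have S[measurable]: "S n \<in> borel_measurable M" for n
    unfolding S_def by measurable
  have c: "0 \<le> c" using bound[of 0] by (meson abs_ge_zero order_trans)
  have S_bound: "\<bar>S n \<omega>\<bar> \<le> real n * c" for n \<omega>
    using sum_norm_bound[of "{1..n}" "\<lambda>j. W j \<omega>" c] bound by (auto simp: S_def)
  have pow_S: "\<bar>S n \<omega> ^ k\<bar> \<le> (real n * c) ^ k" for n \<omega> k
    using S_bound by (auto simp: power_abs intro!: power_mono)
  have pow_W: "\<bar>W n \<omega> ^ k\<bar> \<le> c ^ k" for n \<omega> k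
    using bound by (auto simp: power_abs intro!: power_mono)
  have int: "integrable M (\<lambda>\<omega>. S n \<omega> ^ k * W (Suc n) \<omega> ^ m)" for n k m
    using mult_mono[OF pow_S pow_W] c
    by (intro integrable_const_bound[of _ "(real n * c) ^ k * c ^ m"])
       (auto simp: abs_mult)
  have int_S: "integrable M (\<lambda>\<omega>. S n \<omega> ^ k)" for n k
    using int[of n k 0] by simp
  have int_W: "integrable M (\<lambda>\<omega>. W (Suc n) \<omega> ^ k)" for n k
    using int[of n 0 k] by simp
  have prod: "expectation (\<lambda>\<omega>. S n \<omega> ^ k * W (Suc n) \<omega> ^ m)
     = expectation (\<lambda>\<omega>. S n \<omega> ^ k) * expectation (\<lambda>\<omega>. W (Suc n) \<omega> ^ m)" for n k m
  proof -
    have "indep_vars (\<lambda>_. borel) W (insert (Suc n) {1..n})"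
      by (rule indep_vars_subset[OF indep]) auto
    from indep_vars_sum[OF _ _ this]
    have "indep_var borel (W (Suc n)) borel (S n)"
      by (simp add: S_def)
    from indep_var_bounded_integral_mult[OF this, of "\<lambda>x. x ^ m" "\<lambda>x. x ^ k", OF _ _ pow_W pow_S]
    show ?thesis by (simp add: mult.commute)
  qed
  have S_Suc: "S (Suc n) \<omega> = S n \<omega> + W (Suc n) \<omega>" for n \<omega>
    by (simp add: S_def)
  have mean_S: "expectation (S n) = 0" for n
  proof (induction n)
    case (Suc n)
    then show ?case using int_S[of n 1] int_W[of n 1] mean[of "Suc n"] by (simp add: S_Suc)
  qed (simp add: S_def)
  have var_S: "expectation (\<lambda>\<omega>. (S n \<omega>)\<^sup>2) = (\<Sum>j=1..n. expectation (\<lambda>\<omega>. (W j \<omega>)\<^sup>2))" for n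
  proof (induction n)
    case (Suc n)
    have "(\<lambda>\<omega>. (S (Suc n) \<omega>)\<^sup>2)
      = (\<lambda>\<omega>. (S n \<omega>)\<^sup>2 + 2 * (S n \<omega> ^ 1 * W (Suc n) \<omega> ^ 1) + (W (Suc n) \<omega>)\<^sup>2)"
      by (auto simp: S_Suc power2_eq_square algebra_simps)
    then show ?case
      using Suc int[of n 1 1] int_S[of n 2] int_W[of n 2] prod[of n 1 1] mean_S[of n] by simp
  qed (simp add: S_def)
  have var_le: "expectation (\<lambda>\<omega>. (S n \<omega>)\<^sup>2) \<le> real n * c\<^sup>2" for n
  proof -
    have "expectation (\<lambda>\<omega>. (W j \<omega>)\<^sup>2) \<le> c\<^sup>2" if "j \<in> {1..n}" for j
      using pow_W[of j _ 2] int_W[of "j - 1" 2] that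
      by (intro integral_le_const) (auto intro!: AE_I2)
    from sum_bounded_above[of "{1..n}", OF this] show ?thesis
      by (simp add: var_S)
  qed
  have "expectation (\<lambda>\<omega>. S n \<omega> ^ 4) \<le> 3 * (real n)\<^sup>2 * c ^ 4" for n
  proof (induction n)
    case (Suc n)
    have "(\<lambda>\<omega>. S (Suc n) \<omega> ^ 4) = (\<lambda>\<omega>. S n \<omega> ^ 4 + 4 * (S n \<omega> ^ 3 * W (Suc n) \<omega> ^ 1)
       + 6 * (S n \<omega> ^ 2 * W (Suc n) \<omega> ^ 2) + 4 * (S n \<omega> ^ 1 * W (Suc n) \<omega> ^ 3) + W (Suc n) \<omega> ^ 4)"
      by (auto simp: S_Suc power2_eq_square power3_eq_cube power4_eq_xxxx algebra_simps)
    then have "expectation (\<lambda>\<omega>. S (Suc n) \<omega> ^ 4)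
      = expectation (\<lambda>\<omega>. S n \<omega> ^ 4) + 4 * expectation (\<lambda>\<omega>. S n \<omega> ^ 3 * W (Suc n) \<omega> ^ 1)
       + 6 * expectation (\<lambda>\<omega>. S n \<omega> ^ 2 * W (Suc n) \<omega> ^ 2)
       + 4 * expectation (\<lambda>\<omega>. S n \<omega> ^ 1 * W (Suc n) \<omega> ^ 3) + expectation (\<lambda>\<omega>. W (Suc n) \<omega> ^ 4)"
      by (simp only: Bochner_Integration.integral_add Bochner_Integration.integrable_add
          integrable_mult_right int int_S int_W integral_mult_right_zero)
    also have "\<dots> = expectation (\<lambda>\<omega>. S n \<omega> ^ 4)
       + 6 * (expectation (\<lambda>\<omega>. S n \<omega> ^ 2) * expectation (\<lambda>\<omega>. W (Suc n) \<omega> ^ 2))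
       + expectation (\<lambda>\<omega>. W (Suc n) \<omega> ^ 4)"
      using mean_S[of n] mean[of "Suc n"] prod[of n 3 1] prod[of n 1 3] prod[of n 2 2] by simp
    also have "\<dots> \<le> 3 * (real n)\<^sup>2 * c ^ 4 + 6 * ((real n * c\<^sup>2) * c\<^sup>2) + c ^ 4"
    proof (intro add_mono mult_left_mono mult_mono Suc.IH var_le)
      show "expectation (\<lambda>\<omega>. W (Suc n) \<omega> ^ 2) \<le> c\<^sup>2"
        using pow_W[of _ _ 2] int_W by (intro integral_le_const) (auto intro!: AE_I2)
      show "expectation (\<lambda>\<omega>. W (Suc n) \<omega> ^ 4) \<le> c ^ 4"
        using pow_W[of _ _ 4] int_W by (intro integral_le_const) (auto intro!: AE_I2)
    qed (use c in auto)
    \<comment> \<open>The increment of \<open>3 * n^2\<close> is \<open>6 * n + 3\<close>, which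
      covers the \<open>6 * n + 1\<close> produced by the expansion.\<close>
    also have "\<dots> \<le> 3 * (real (Suc n))\<^sup>2 * c ^ 4"
    proof -
      have "3 * (real (Suc n))\<^sup>2 * c ^ 4
        = 3 * (real n)\<^sup>2 * c ^ 4 + 6 * ((real n * c\<^sup>2) * c\<^sup>2) + 3 * c ^ 4"
        by (simp add: power2_eq_square power4_eq_xxxx algebra_simps)
      then show ?thesis by simp
    qed
    finally show ?case .
  qed (simp add: S_def)
  then show "expectation (\<lambda>\<omega>. (\<Sum>j=1..n. W j \<omega>) ^ 4) \<le> 3 * (real n)\<^sup>2 * c ^ 4"
    unfolding S_def .
  show "expectation (\<lambda>\<omega>. \<Sum>j=1..n. W j \<omega>) = 0"
    using mean_S[of n] by (simp add: S_def)
  show "expectation (\<lambda>\<omega>. (\<Sum>j=1..n. W j \<omega>)\<^sup>2) = (\<Sum>j=1..n. expectation (\<lambda>\<omega>. (W j \<omega>)\<^sup>2))"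
    using var_S[of n] by (simp add: S_def)
qed

text \<open>Cauchy-Schwarz, because the mean of \<open>(U + t * V)^2\<close> is a nonnegative
  quadratic polynomial in \<open>t\<close>. With \<open>V\<close> constantly 1 it also yields
  integrability of \<open>U\<close> and bounds the squared mean by the second moment.\<close>

lemma (in prob_space) expectation_mult_square_le:
  fixes U V :: "'a \<Rightarrow> real"
  assumes [measurable]: "U \<in> borel_measurable M" "V \<in> borel_measurable M"
    and "integrable M (\<lambda>\<omega>. (U \<omega>)\<^sup>2)" "integrable M (\<lambda>\<omega>. (V \<omega>)\<^sup>2)"
  shows "integrable M (\<lambda>\<omega>. U \<omega> * V \<omega>)"
    and "(expectation (\<lambda>\<omega>. U \<omega> * V \<omega>))\<^sup>2 \<le> expectation (\<lambda>\<omega>. (U \<omega>)\<^sup>2) * expectation (\<lambda>\<omega>. (V \<omega>)\<^sup>2)"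
proof -
  have amgm: "norm (x * y) \<le> norm (x\<^sup>2 + y\<^sup>2)" for x y :: real
  proof -
    have "0 \<le> (\<bar>x\<bar> - \<bar>y\<bar>)\<^sup>2" by simp
    then have "2 * \<bar>x * y\<bar> \<le> x\<^sup>2 + y\<^sup>2" by (simp add: power2_diff abs_mult)
    then show ?thesis unfolding real_norm_def by linarith
  qed
  show int: "integrable M (\<lambda>\<omega>. U \<omega> * V \<omega>)"
  proof (rule Bochner_Integration.integrable_bound)
    show "integrable M (\<lambda>\<omega>. (U \<omega>)\<^sup>2 + (V \<omega>)\<^sup>2)" using assms by simp
    show "AE \<omega> in M. norm (U \<omega> * V \<omega>) \<le> norm ((U \<omega>)\<^sup>2 + (V \<omega>)\<^sup>2)"
      by (rule AE_I2) (rule amgm)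
  qed measurable
  define p q m where "p = expectation (\<lambda>\<omega>. (U \<omega>)\<^sup>2)" and "q = expectation (\<lambda>\<omega>. (V \<omega>)\<^sup>2)"
    and "m = expectation (\<lambda>\<omega>. U \<omega> * V \<omega>)"
  have quad: "0 \<le> p + 2 * t * m + t\<^sup>2 * q" for t
  proof -
    have "0 \<le> expectation (\<lambda>\<omega>. (U \<omega> + t * V \<omega>)\<^sup>2)" by simp
    also have "(\<lambda>\<omega>. (U \<omega> + t * V \<omega>)\<^sup>2) = (\<lambda>\<omega>. (U \<omega>)\<^sup>2 + 2 * t * (U \<omega> * V \<omega>) + t\<^sup>2 * (V \<omega>)\<^sup>2)"
      by (auto simp: power2_eq_square algebra_simps)
    also have "expectation \<dots> = p + 2 * t * m + t\<^sup>2 * q"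
      using assms int by (simp add: p_def q_def m_def)
    finally show ?thesis .
  qed
  have "q \<ge> 0" by (simp add: q_def)
  have "m\<^sup>2 \<le> p * q"
  \<comment> \<open>If \<open>q = 0\<close>, the polynomial is affine in \<open>t\<close>, and for
    nonzero \<open>m\<close> the chosen \<open>t\<close> would give it the value -1. Otherwise it is
    evaluated at its minimiser \<open>- m / q\<close>.\<close>
  proof (cases "q = 0")
    case True
    have "m = 0"
    proof (rule ccontr)
      assume "m \<noteq> 0"
      then show False using quad[of "- (p + 1) / (2 * m)"] True by (simp add: field_simps)
    qed
    then show ?thesis using True by simp
  next
    case False
    then have "q > 0" using \<open>q \<ge> 0\<close> by simp
    then have "0 \<le> p - m\<^sup>2 / q"
      using quad[of "- m / q"] by (simp add: field_simps power2_eq_square)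
    then show ?thesis using \<open>q > 0\<close> by (simp add: field_simps)
  qed
  then show "(expectation (\<lambda>\<omega>. U \<omega> * V \<omega>))\<^sup>2 \<le> expectation (\<lambda>\<omega>. (U \<omega>)\<^sup>2) * expectation (\<lambda>\<omega>. (V \<omega>)\<^sup>2)"
    by (simp add: p_def q_def m_def)
qed

section \<open>Perturbations that are small in mean square\<close>

text \<open>The square of \<open>Z + R\<close> is expanded, and Cauchy-Schwarz bounds the squared
  mean of \<open>Z * R\<close> by \<open>v\<close> times the second moment of \<open>R\<close>. The
  value \<open>v\<close> is prescribed for \<open>n \<ge> 1\<close> only, because the empirical
  process that will take the place of \<open>Z\<close> is zero at \<open>n = 0\<close>.\<close>

lemma (in prob_space) variance_perturbation_tendsto:
  fixes Z R :: "nat \<Rightarrow> 'a \<Rightarrow> real"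
  assumes [measurable]: "\<And>n. Z n \<in> borel_measurable M" "\<And>n. R n \<in> borel_measurable M"
    and Z2: "\<And>n. integrable M (\<lambda>\<omega>. (Z n \<omega>)\<^sup>2)" and R2: "\<And>n. integrable M (\<lambda>\<omega>. (R n \<omega>)\<^sup>2)"
    and Z: "\<And>n. expectation (Z n) = 0" "\<And>n. n \<ge> 1 \<Longrightarrow> expectation (\<lambda>\<omega>. (Z n \<omega>)\<^sup>2) = v"
    and R: "(\<lambda>n. expectation (\<lambda>\<omega>. (R n \<omega>)\<^sup>2)) \<longlonglongrightarrow> 0"
  shows "(\<lambda>n. expectation (R n)) \<longlonglongrightarrow> 0"
    and "(\<lambda>n. variance (\<lambda>\<omega>. Z n \<omega> + R n \<omega>)) \<longlonglongrightarrow> v"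
proof -
  have iZ: "integrable M (Z n)" and iR: "integrable M (R n)" for n
    using expectation_mult_square_le(1)[of "Z n" "\<lambda>_. 1"] expectation_mult_square_le(1)[of "R n" "\<lambda>_. 1"]
      Z2 R2 by simp_all
  have sqrt0: "(\<lambda>n. x n) \<longlonglongrightarrow> 0" if "(\<lambda>n. (x n)\<^sup>2) \<longlonglongrightarrow> 0" for x :: "nat \<Rightarrow> real"
    using tendsto_real_sqrt[OF that] by (simp add: tendsto_rabs_zero_iff)
  have R_sq: "(\<lambda>n. (expectation (R n))\<^sup>2) \<longlonglongrightarrow> 0"
  proof (rule tendsto_sandwich[OF _ _ tendsto_const R])
    show "\<forall>\<^sub>F n in sequentially. (expectation (R n))\<^sup>2 \<le> expectation (\<lambda>\<omega>. (R n \<omega>)\<^sup>2)"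
    proof (rule always_eventually, rule allI)
      fix n show "(expectation (R n))\<^sup>2 \<le> expectation (\<lambda>\<omega>. (R n \<omega>)\<^sup>2)"
        using expectation_mult_square_le(2)[of "R n" "\<lambda>_. 1"] R2 by (simp add: prob_space)
    qed
  qed simp
  then show R0: "(\<lambda>n. expectation (R n)) \<longlonglongrightarrow> 0"
    by (rule sqrt0)
  have "(\<lambda>n. (expectation (\<lambda>\<omega>. Z n \<omega> * R n \<omega>))\<^sup>2) \<longlonglongrightarrow> 0"
  proof (rule tendsto_sandwich[OF _ _ tendsto_const])
    show "\<forall>\<^sub>F n in sequentially.
      (expectation (\<lambda>\<omega>. Z n \<omega> * R n \<omega>))\<^sup>2 \<le> v * expectation (\<lambda>\<omega>. (R n \<omega>)\<^sup>2)"
      using eventually_ge_at_top[of 1]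
    proof eventually_elim
      case (elim n)
      then show ?case using expectation_mult_square_le(2)[of "Z n" "R n"] Z2 R2 Z(2) by simp
    qed
    show "(\<lambda>n. v * expectation (\<lambda>\<omega>. (R n \<omega>)\<^sup>2)) \<longlonglongrightarrow> 0"
      using tendsto_mult_right_zero[OF R] by simp
  qed simp
  then have ZR: "(\<lambda>n. expectation (\<lambda>\<omega>. Z n \<omega> * R n \<omega>)) \<longlonglongrightarrow> 0"
    by (rule sqrt0)
  have "(\<lambda>n. v + 2 * expectation (\<lambda>\<omega>. Z n \<omega> * R n \<omega>) + expectation (\<lambda>\<omega>. (R n \<omega>)\<^sup>2) - (expectation (R n))\<^sup>2)
    \<longlonglongrightarrow> v + 2 * 0 + 0 - 0"
    by (intro tendsto_intros ZR R R_sq)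
  moreover have "\<forall>\<^sub>F n in sequentially.
    v + 2 * expectation (\<lambda>\<omega>. Z n \<omega> * R n \<omega>) + expectation (\<lambda>\<omega>. (R n \<omega>)\<^sup>2) - (expectation (R n))\<^sup>2
    = variance (\<lambda>\<omega>. Z n \<omega> + R n \<omega>)"
    using eventually_ge_at_top[of 1]
  proof eventually_elim
    case (elim n)
    have ZRi: "integrable M (\<lambda>\<omega>. Z n \<omega> * R n \<omega>)"
      using expectation_mult_square_le(1)[of "Z n" "R n"] Z2 R2 by simp
    have "(\<lambda>\<omega>. (Z n \<omega> + R n \<omega>)\<^sup>2) = (\<lambda>\<omega>. (Z n \<omega>)\<^sup>2 + 2 * (Z n \<omega> * R n \<omega>) + (R n \<omega>)\<^sup>2)"
      by (auto simp: power2_eq_square algebra_simps)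
    then show ?case
      using iZ iR Z2 R2 ZRi Z elim by (subst variance_eq) auto
  qed
  ultimately show "(\<lambda>n. variance (\<lambda>\<omega>. Z n \<omega> + R n \<omega>)) \<longlonglongrightarrow> v"
    by (auto dest: Lim_transform_eventually)
qed

text \<open>Two uses of \<open>(a + b)^2 \<le> 2 * a^2 + 2 * b^2\<close>, whence the constant
  8.\<close>

lemma power4_add_le: "(x + y :: real) ^ 4 \<le> 8 * x ^ 4 + 8 * y ^ 4"
proof -
  have "(x + y)\<^sup>2 \<le> 2 * x\<^sup>2 + 2 * y\<^sup>2"
    using zero_le_power2[of "x - y"] by (simp add: power2_sum power2_diff)
  then have "((x + y)\<^sup>2)\<^sup>2 \<le> (2 * x\<^sup>2 + 2 * y\<^sup>2)\<^sup>2"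
    by (intro power_mono) auto
  also have "\<dots> \<le> 8 * (x\<^sup>2)\<^sup>2 + 8 * (y\<^sup>2)\<^sup>2"
    using zero_le_power2[of "x\<^sup>2 - y\<^sup>2"] by (simp add: power2_sum power2_diff algebra_simps)
  finally show ?thesis by (simp flip: power_mult)
qed

text \<open>Bounded fourth moments make the squares uniformly integrable. Explicitly, the square is
  at most \<open>\<kappa>^2\<close> where \<open>\<bar>R n\<bar> \<le> \<kappa>\<close>, and
  elsewhere at most \<open>\<eta> * R^4 + 1 / \<eta>\<close>. The fourth power costs at most
  \<open>\<eta> * K\<close>, and \<open>1 / \<eta>\<close> is multiplied by a probability that tends
  to 0.\<close>

lemma (in prob_space) square_expectation_tendsto_0:
  fixes R :: "nat \<Rightarrow> 'a \<Rightarrow> real"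
  assumes [measurable]: "\<And>n. R n \<in> borel_measurable M"
    and int: "\<And>n. integrable M (\<lambda>\<omega>. (R n \<omega>) ^ 4)"
    and bound: "\<And>n. n \<ge> 1 \<Longrightarrow> expectation (\<lambda>\<omega>. (R n \<omega>) ^ 4) \<le> K"
    and in_prob: "\<And>\<kappa>. \<kappa> > 0 \<Longrightarrow> (\<lambda>n. prob {\<omega> \<in> space M. \<bar>R n \<omega>\<bar> > \<kappa>}) \<longlonglongrightarrow> 0"
  shows "(\<lambda>n. expectation (\<lambda>\<omega>. (R n \<omega>)\<^sup>2)) \<longlonglongrightarrow> 0"
proof -
  have K: "0 \<le> K" 
    by (rule order_trans[OF Bochner_Integration.integral_nonneg bound[of 1]]) auto
  have key: "expectation (\<lambda>\<omega>. (R n \<omega>)\<^sup>2)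
      \<le> \<kappa>\<^sup>2 + \<eta> * K + prob {\<omega> \<in> space M. \<bar>R n \<omega>\<bar> > \<kappa>} / \<eta>"
    if "\<kappa> > 0" "\<eta> > 0" "n \<ge> 1" for \<kappa> \<eta> n
  proof -
    let ?E = "{\<omega> \<in> space M. \<bar>R n \<omega>\<bar> > \<kappa>}"
    have pt: "(R n \<omega>)\<^sup>2 \<le> \<kappa>\<^sup>2 + \<eta> * (R n \<omega>) ^ 4 + indicator ?E \<omega> / \<eta>" if "\<omega> \<in> space M" for \<omega>
    proof (cases "\<bar>R n \<omega>\<bar> > \<kappa>")
      case False
      then have "(R n \<omega>)\<^sup>2 \<le> \<kappa>\<^sup>2"
        using power_mono[of "\<bar>R n \<omega>\<bar>" \<kappa> 2] by simp
      moreover have "0 \<le> \<eta> * (R n \<omega>) ^ 4 + indicator ?E \<omega> / \<eta>"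
        using \<open>\<eta> > 0\<close> by simp
      ultimately show ?thesis by linarith
    next
      case True
      define q where "q = (R n \<omega>)\<^sup>2"
      have "0 \<le> (\<eta> * q - 1)\<^sup>2 / \<eta> + q" using \<open>\<eta> > 0\<close> by (simp add: q_def)
      also have "(\<eta> * q - 1)\<^sup>2 / \<eta> + q = \<eta> * q\<^sup>2 - q + 1 / \<eta>"
        using \<open>\<eta> > 0\<close> by (simp add: field_simps power2_eq_square)
      also have "q\<^sup>2 = (R n \<omega>) ^ 4" by (simp add: q_def flip: power_mult)
      finally have "q \<le> \<eta> * (R n \<omega>) ^ 4 + 1 / \<eta>" by simp
      moreover have "indicator ?E \<omega> = (1::real)" using True that by simp
      ultimately show ?thesis unfolding q_def by (smt (verit) zero_le_power2)
    qed
    have int_rhs: "integrable M (\<lambda>\<omega>. \<kappa>\<^sup>2 + \<eta> * (R n \<omega>) ^ 4 + indicator ?E \<omega> / \<eta>)"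
      using int[of n] by (auto intro!: Bochner_Integration.integrable_add integrable_divide simp: emeasure_eq_measure)
    have "expectation (\<lambda>\<omega>. (R n \<omega>)\<^sup>2) \<le> expectation (\<lambda>\<omega>. \<kappa>\<^sup>2 + \<eta> * (R n \<omega>) ^ 4 + indicator ?E \<omega> / \<eta>)"
    proof (rule integral_mono_AE)
      show "integrable M (\<lambda>\<omega>. (R n \<omega>)\<^sup>2)"
        using pt by (intro Bochner_Integration.integrable_bound[OF int_rhs]) (auto intro!: AE_I2 order_trans[OF _ abs_ge_self])
    qed (use pt int_rhs in \<open>auto intro!: AE_I2\<close>)
    also have "\<dots> = \<kappa>\<^sup>2 + \<eta> * expectation (\<lambda>\<omega>. (R n \<omega>) ^ 4) + prob ?E / \<eta>"
      using int[of n] by (subst Bochner_Integration.integral_add) (auto simp: prob_space emeasure_eq_measure intro!: Bochner_Integration.integrable_add)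
    also have "\<dots> \<le> \<kappa>\<^sup>2 + \<eta> * K + prob ?E / \<eta>"
      using bound \<open>n \<ge> 1\<close> \<open>\<eta> > 0\<close> by (intro add_mono mult_left_mono) auto
    finally show ?thesis .
  qed
  show ?thesis
  proof (rule tendstoI)
    fix e :: real assume "e > 0"
    \<comment> \<open>Neither constant depends on \<open>n\<close>. Each of the first two terms of
      \<open>key\<close> takes at most a third of \<open>e\<close>, which leaves a third for the
      probability. The summand 1 in \<open>K + 1\<close> keeps the denominator positive when
      \<open>K = 0\<close>.\<close>
    define \<kappa> where "\<kappa> = sqrt (e / 3)"
    define \<eta> where "\<eta> = e / (3 * (K + 1))"
    have pos: "\<kappa> > 0" "\<eta> > 0" using \<open>e > 0\<close> K by (auto simp: \<kappa>_def \<eta>_def)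
    have "\<kappa>\<^sup>2 = e / 3" using \<open>e > 0\<close> by (simp add: \<kappa>_def)
    have "\<eta> * K < e / 3" using \<open>e > 0\<close> K by (simp add: \<eta>_def field_simps)
    have "(\<lambda>n. prob {\<omega> \<in> space M. \<bar>R n \<omega>\<bar> > \<kappa>} / \<eta>) \<longlonglongrightarrow> 0 / \<eta>"
      by (intro tendsto_divide in_prob tendsto_const) (use pos in auto)
    then have "\<forall>\<^sub>F n in sequentially. prob {\<omega> \<in> space M. \<bar>R n \<omega>\<bar> > \<kappa>} / \<eta> < e / 3"
      using \<open>e > 0\<close> by (intro order_tendstoD) auto
    then show "\<forall>\<^sub>F n in sequentially. dist (expectation (\<lambda>\<omega>. (R n \<omega>)\<^sup>2)) 0 < e"
      using eventually_ge_at_top[of 1]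
    proof eventually_elim
      case (elim n)
      then show ?case
        using key[OF pos elim(2)] \<open>\<kappa>\<^sup>2 = e / 3\<close> \<open>\<eta> * K < e / 3\<close> by (simp add: field_simps)
    qed
  qed
qed

text \<open>The pair has the product law, under which the diagonal is null by Fubini, since each of
  its sections is a single point without mass.\<close>

lemma (in prob_space) indep_continuous_AE_neq:
  fixes U V :: "'a \<Rightarrow> real"
  assumes "indep_var borel U borel V" "\<And>x. measure (distr M borel V) {x} = 0"
  shows "AE \<omega> in M. U \<omega> \<noteq> V \<omega>"
proof -
  have [measurable]: "U \<in> borel_measurable M" "V \<in> borel_measurable M"
    using assms(1) by (auto dest: indep_var_rv1 indep_var_rv2)
  interpret U: prob_space "distr M borel U" by (rule prob_space_distr) simp
  interpret V: prob_space "distr M borel V" by (rule prob_space_distr) simp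
  interpret UV: pair_prob_space "distr M borel U" "distr M borel V" ..
  have "AE y in distr M borel V. x \<noteq> y" for x
    using assms(2)[of x] by (subst AE_iff_measurable[where N = "{x}"])
      (auto simp: V.emeasure_eq_measure)
  moreover have meas: "{z :: real \<times> real. fst z \<noteq> snd z} \<in> sets (borel \<Otimes>\<^sub>M borel)"
    unfolding borel_prod by (intro borel_open open_Collect_neq continuous_intros)
  ultimately have "AE z in distr M borel U \<Otimes>\<^sub>M distr M borel V. fst z \<noteq> snd z"
    by (intro UV.AE_pair_measure)
      (auto simp: space_pair_measure cong: sets_pair_measure_cong)
  then have "AE z in distr M (borel \<Otimes>\<^sub>M borel) (\<lambda>\<omega>. (U \<omega>, V \<omega>)). fst z \<noteq> snd z"
    using assms(1) unfolding indep_var_distribution_eq by metis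
  then show ?thesis
    by (subst (asm) AE_distr_iff) (auto simp: space_pair_measure meas)
qed

section \<open>Normalised empirical processes\<close>

locale iid_sample = prob_space M for M :: "'a measure" +
  fixes N :: "'b measure" and P :: "nat \<Rightarrow> 'a \<Rightarrow> 'b"
  assumes indep: "indep_vars (\<lambda>_. N) P {1..}"
    and ident: "j \<ge> 1 \<Longrightarrow> distr M N (P j) = distr M N (P 1)"
begin

lemma measurable_P [measurable]: "j \<ge> 1 \<Longrightarrow> P j \<in> measurable M N"
  using indep by (auto simp: indep_vars_def)

definition mu :: "('b \<Rightarrow> real) \<Rightarrow> real" where
  "mu f = expectation (\<lambda>\<omega>. f (P 1 \<omega>))"

text \<open>Indexed by functions instead of thresholds, so that marginal, joint and increment
  processes and their linear combinations share the same moment bounds. Division by zero makes the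
  process 0 at \<open>n = 0\<close>.\<close>

definition emp_process :: "nat \<Rightarrow> ('b \<Rightarrow> real) \<Rightarrow> 'a \<Rightarrow> real" where
  "emp_process n f \<omega> = (\<Sum>j=1..n. f (P j \<omega>) - mu f) / sqrt (real n)"

lemma expectation_P:
  assumes [measurable]: "f \<in> borel_measurable N" and "j \<ge> 1"
  shows "expectation (\<lambda>\<omega>. f (P j \<omega>)) = mu f"
proof -
  have "expectation (\<lambda>\<omega>. f (P j \<omega>)) = integral\<^sup>L (distr M N (P j)) f"
    using assms by (subst integral_distr) auto
  also have "\<dots> = mu f"
    unfolding ident[OF \<open>j \<ge> 1\<close>] mu_def by (subst integral_distr) auto
  finally show ?thesis .
qed

lemma integrable_P:
  fixes f :: "'b \<Rightarrow> real"
  assumes [measurable]: "f \<in> borel_measurable N" and "j \<ge> 1" "\<And>x. \<bar>f x\<bar> \<le> c"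
  shows "integrable M (\<lambda>\<omega>. f (P j \<omega>))"
  using assms by (intro integrable_const_bound[of _ c]) auto

lemma measurable_emp_process [measurable]:
  assumes [measurable]: "f \<in> borel_measurable N"
  shows "emp_process n f \<in> borel_measurable M"
  unfolding emp_process_def by measurable

lemma abs_mu_le:
  assumes "f \<in> borel_measurable N" "\<And>x. \<bar>f x\<bar> \<le> c"
  shows "\<bar>mu f\<bar> \<le> c"
proof -
  have "norm (mu f) \<le> expectation (\<lambda>\<omega>. norm (f (P 1 \<omega>)))"
    unfolding mu_def by (rule integral_norm_bound)
  also have "\<dots> \<le> c"
    using assms integrable_P[OF assms(1) order_refl assms(2)]
    by (intro integral_le_const) (auto intro!: AE_I2)
  finally show ?thesis by simp
qed

text \<open>The centred summands are independent and bounded by \<open>2 * c\<close>; the constant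
  48 is \<open>3 * 2^4\<close>.\<close>

lemma emp_process_moments:
  assumes [measurable]: "f \<in> borel_measurable N" and c: "\<And>x. \<bar>f x\<bar> \<le> c"
  shows "expectation (emp_process n f) = 0"
    and "n \<ge> 1 \<Longrightarrow> expectation (\<lambda>\<omega>. (emp_process n f \<omega>)\<^sup>2) = mu (\<lambda>x. (f x)\<^sup>2) - (mu f)\<^sup>2"
    and "expectation (\<lambda>\<omega>. (emp_process n f \<omega>) ^ 4) \<le> 48 * c ^ 4"
proof -
  define W where "W = (\<lambda>j \<omega>. if j \<ge> 1 then f (P j \<omega>) - mu f else 0)"
  have "\<bar>f x - mu f\<bar> \<le> 2 * c" for x
    using c[of x] abs_mu_le[OF assms] by linarith
  moreover have c0: "0 \<le> c" using c by (meson abs_ge_zero order_trans)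
  ultimately have W_bound: "\<bar>W j \<omega>\<bar> \<le> 2 * c" for j \<omega>
    by (auto simp: W_def)
  have intf: "integrable M (\<lambda>\<omega>. f (P j \<omega>))" if "j \<ge> 1" for j
    using integrable_P[OF assms(1) that c] .
  have f2: "\<bar>(f x)\<^sup>2\<bar> \<le> c\<^sup>2" for x using power_mono[OF c[of x], of 2] by simp
  have intf2: "integrable M (\<lambda>\<omega>. (f (P j \<omega>))\<^sup>2)" if "j \<ge> 1" for j
    using integrable_P[OF _ that f2] by measurable
  have "indep_vars (\<lambda>_. borel) (\<lambda>j \<omega>. f (P j \<omega>) - mu f) {1..}"
    by (rule indep_vars_compose2[OF indep]) auto
  moreover have "indep_vars (\<lambda>_. borel) (\<lambda>j \<omega>. f (P j \<omega>) - mu f) {1..}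
    \<longleftrightarrow> indep_vars (\<lambda>_. borel) W {1..}"
    by (rule indep_vars_cong) (auto simp: W_def)
  ultimately have indW: "indep_vars (\<lambda>_. borel) W {1..}"
    by simp
  have W0: "expectation (W j) = 0" if "j \<ge> 1" for j
    using that intf expectation_P[OF assms(1) that] by (simp add: W_def prob_space)
  have eW: "emp_process n f \<omega> = (\<Sum>j=1..n. W j \<omega>) / sqrt (real n)" for \<omega>
    by (simp add: emp_process_def W_def)
  note mom = indep_sum_moments[OF indW W_bound W0]
  show "expectation (emp_process n f) = 0"
    using mom(1)[of n] by (simp add: eW[abs_def])
  show "expectation (\<lambda>\<omega>. (emp_process n f \<omega>)\<^sup>2) = mu (\<lambda>x. (f x)\<^sup>2) - (mu f)\<^sup>2" if "n \<ge> 1"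
  proof -
    have "expectation (\<lambda>\<omega>. (W j \<omega>)\<^sup>2) = mu (\<lambda>x. (f x)\<^sup>2) - (mu f)\<^sup>2" if "j \<in> {1..n}" for j
    proof -
      have j: "j \<ge> 1" using that by simp
      then have "expectation (\<lambda>\<omega>. (W j \<omega>)\<^sup>2)
        = expectation (\<lambda>\<omega>. (f (P j \<omega>))\<^sup>2 - 2 * mu f * f (P j \<omega>) + (mu f)\<^sup>2)"
        by (simp add: W_def power2_diff algebra_simps)
      also have "\<dots> = mu (\<lambda>x. (f x)\<^sup>2) - 2 * mu f * mu f + (mu f)\<^sup>2"
        using intf[OF j] intf2[OF j] expectation_P[OF assms(1) j]
          expectation_P[OF _ j, of "\<lambda>x. (f x)\<^sup>2"] by (simp add: prob_space)
      finally show ?thesis by (simp add: power2_eq_square)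
    qed
    then show ?thesis
      using mom(2)[of n] \<open>n \<ge> 1\<close> by (simp add: eW power_divide)
  qed
  show "expectation (\<lambda>\<omega>. (emp_process n f \<omega>) ^ 4) \<le> 48 * c ^ 4"
  proof (cases "n = 0")
    case False
    have "sqrt (real n) ^ 4 = (real n)\<^sup>2"
      by (metis (no_types) numeral_Bit0 of_nat_0_le_iff power2_eq_square power4_eq_xxxx
          real_sqrt_pow2 mult.assoc)
    then show ?thesis
      using mom(3)[of n] False by (simp add: eW power_divide power_mult_distrib field_simps)
  qed (simp add: emp_process_def)
qed

lemma emp_process_diff:
  assumes "f \<in> borel_measurable N" "\<And>x. \<bar>f x\<bar> \<le> b"
    and "g \<in> borel_measurable N" "\<And>x. \<bar>g x\<bar> \<le> c"
  shows "emp_process n (\<lambda>x. f x - g x) \<omega> = emp_process n f \<omega> - emp_process n g \<omega>"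
proof -
  have "mu (\<lambda>x. f x - g x) = mu f - mu g"
    unfolding mu_def
    using integrable_P[OF assms(1) order_refl assms(2)] integrable_P[OF assms(3) order_refl assms(4)]
    by simp
  then show ?thesis
    by (simp add: emp_process_def sum_subtractf diff_divide_distrib[symmetric] right_diff_distrib)
qed

lemma emp_process_cmult: "emp_process n (\<lambda>x. c * f x) \<omega> = c * emp_process n f \<omega>"
  unfolding emp_process_def mu_def
  by (simp add: sum_distrib_left right_diff_distrib)

lemma integrable_emp_process_power:
  assumes [measurable]: "f \<in> borel_measurable N" and c: "\<And>x. \<bar>f x\<bar> \<le> c"
  shows "integrable M (\<lambda>\<omega>. emp_process n f \<omega> ^ k)"
proof -
  have b: "\<bar>emp_process n f \<omega>\<bar> \<le> real n * (2 * c) / sqrt (real n)" for \<omega>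
  proof -
    have "\<bar>f x - mu f\<bar> \<le> 2 * c" for x
      using c[of x] abs_mu_le[OF assms(1) c] by linarith
    then have "\<bar>\<Sum>j=1..n. f (P j \<omega>) - mu f\<bar> \<le> real n * (2 * c)"
      using sum_norm_bound[of "{1..n}" "\<lambda>j. f (P j \<omega>) - mu f" "2 * c"] by auto
    then show ?thesis
      by (simp add: emp_process_def divide_right_mono)
  qed
  have "\<bar>emp_process n f \<omega> ^ k\<bar> \<le> (real n * (2 * c) / sqrt (real n)) ^ k" for \<omega>
    unfolding power_abs by (intro power_mono b) simp
  then show ?thesis
    by (intro integrable_const_bound[of _ "(real n * (2 * c) / sqrt (real n)) ^ k"]) auto
qed

lemma emp_process_square_le:
  assumes "f \<in> borel_measurable N" "\<And>x. \<bar>f x\<bar> \<le> c" "n \<ge> 1"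
  shows "expectation (\<lambda>\<omega>. (emp_process n f \<omega>)\<^sup>2) \<le> mu (\<lambda>x. (f x)\<^sup>2)"
  using emp_process_moments(2)[OF assms] by simp

end

section \<open>Empirical copulas and ranks\<close>

text \<open>The thresholds are on the scale of the observations, not on that of ranks as in
  \<open>emp_copula\<close>. For fixed thresholds and an i.i.d. sample this is an average of i.i.d.
  terms, to which the empirical process applies.\<close>

definition emp_joint_cdf ::
  "nat \<Rightarrow> (nat \<Rightarrow> real) \<Rightarrow> (nat \<Rightarrow> real) \<Rightarrow> real \<Rightarrow> real \<Rightarrow> real" where
  "emp_joint_cdf n x y s t = (\<Sum>j=1..n. of_bool (x j \<le> s) * of_bool (y j \<le> t)) / real n"

lemma emp_cdf_mono: "s \<le> t \<Longrightarrow> emp_cdf n x s \<le> emp_cdf n x t"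
  unfolding emp_cdf_def by (intro divide_right_mono sum_mono) auto

text \<open>Lower half of the squeeze: a point below \<open>s\<close> has normalised rank at most
  \<open>emp_cdf n x s\<close>, hence at most \<open>u\<close>.\<close>

lemma emp_joint_cdf_le_emp_copula:
  assumes "emp_cdf n x s \<le> u" "emp_cdf n y t \<le> v"
  shows "emp_joint_cdf n x y s t \<le> emp_copula n x y u v"
  unfolding emp_joint_cdf_def emp_copula_def
  using assms emp_cdf_mono[of _ s n x] emp_cdf_mono[of _ t n y]
  by (intro divide_right_mono sum_mono mult_mono) (auto intro: order_trans)

text \<open>Upper half of the squeeze, by contraposition: a point above \<open>s\<close> has
  normalised rank at least \<open>emp_cdf n x s\<close>. The inequality must be strict here, so that
  this rank exceeds \<open>u\<close>.\<close>

lemma emp_copula_le_emp_joint_cdf: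
  assumes "u < emp_cdf n x s" "v < emp_cdf n y t"
  shows "emp_copula n x y u v \<le> emp_joint_cdf n x y s t"
proof -
  have "x j \<le> s" if "emp_cdf n x (x j) \<le> u" for j
    using that assms(1) emp_cdf_mono[of s "x j" n x] by fastforce
  moreover have "y j \<le> t" if "emp_cdf n y (y j) \<le> v" for j
    using that assms(2) emp_cdf_mono[of t "y j" n y] by fastforce
  ultimately show ?thesis
    unfolding emp_joint_cdf_def emp_copula_def
    by (intro divide_right_mono sum_mono mult_mono) auto
qed

lemma emp_cdf_eq_card: "real n * emp_cdf n x t = real (card {j\<in>{1..n}. x j \<le> t})"
  unfolding emp_cdf_def
  by (cases "n = 0") (auto simp: sum.If_cases of_bool_def Int_def)

text \<open>Both index sets are initial segments in the order of the sample, hence nested. Without ties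
  the set of low ranks has more than \<open>n u - 1\<close> elements if it is the smaller one.\<close>

lemma rank_le_vs_sample_le:
  assumes inj: "inj_on x {1..n}" and "0 \<le> u"
  shows "(\<Sum>j=1..n. \<bar>of_bool (emp_cdf n x (x j) \<le> u) - of_bool (x j \<le> s)\<bar>)
    \<le> real n * \<bar>emp_cdf n x s - u\<bar> + (1 :: real)"
proof -
  define a where "a = {j\<in>{1..n}. emp_cdf n x (x j) \<le> u}"
  define b where "b = {j\<in>{1..n}. x j \<le> s}"
  have fin: "finite a" "finite b" by (auto simp: a_def b_def)
  have card_b: "real (card b) = real n * emp_cdf n x s"
    by (simp add: b_def emp_cdf_eq_card)
  have sum_eq: "(\<Sum>j=1..n. \<bar>of_bool (emp_cdf n x (x j) \<le> u) - of_bool (x j \<le> s)\<bar>)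
    = real (card ((a - b) \<union> (b - a)))"
  proof -
    have "(\<Sum>j=1..n. \<bar>of_bool (emp_cdf n x (x j) \<le> u) - of_bool (x j \<le> s)\<bar> :: real)
      = (\<Sum>j=1..n. of_bool (j \<in> (a - b) \<union> (b - a)))"
      by (intro sum.cong) (auto simp: a_def b_def)
    also have "\<dots> = real (card ({1..n} \<inter> ((a - b) \<union> (b - a))))"
      by (simp add: of_bool_def sum.If_cases Int_def)
    also have "{1..n} \<inter> ((a - b) \<union> (b - a)) = (a - b) \<union> (b - a)"
      by (auto simp: a_def b_def)
    finally show ?thesis .
  qed
  show ?thesis
  proof (cases "emp_cdf n x s \<le> u")
    case True
    then have sub: "b \<subseteq> a"
      using emp_cdf_mono[of _ s n x] by (force simp: a_def b_def)
    have "real (card a) \<le> real n * u"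
    proof (cases "a = {}")
      case False
      then obtain m where m: "m \<in> a" "\<And>j. j \<in> a \<Longrightarrow> x j \<le> x m"
        using fin(1) arg_min_if_finite[of a "\<lambda>j. - x j"] by (metis neg_less_iff_less not_less)
      then have "card a \<le> card {j\<in>{1..n}. x j \<le> x m}"
        by (intro card_mono) (auto simp: a_def)
      then have "real (card a) \<le> real n * emp_cdf n x (x m)"
        by (simp add: emp_cdf_eq_card)
      also have "\<dots> \<le> real n * u"
        using m(1) by (intro mult_left_mono) (auto simp: a_def)
      finally show ?thesis .
    qed (use \<open>0 \<le> u\<close> in simp)
    moreover have "(a - b) \<union> (b - a) = a - b" using sub by auto
    ultimately show ?thesis
      using True card_mono[OF fin(1) sub] unfolding sum_eq
      by (simp add: card_Diff_subset[OF fin(2) sub] card_b right_diff_distrib)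
  next
    case False
    have "x j \<le> s" if "emp_cdf n x (x j) \<le> u" for j
      using that False emp_cdf_mono[of s "x j" n x] by fastforce
    then have sub: "a \<subseteq> b"
      by (auto simp: a_def b_def)
    show ?thesis
    proof (cases "b - a = {}")
      case True
      with sub have eq: "(a - b) \<union> (b - a) = {}" by auto
      show ?thesis unfolding sum_eq eq by simp
    next
      case False
      \<comment> \<open>The lowest point of \<open>b\<close> that is missing from \<open>a\<close>.
        All points strictly below it lie in \<open>a\<close>, and without ties only \<open>i\<close>
        itself is added at its level. Since its rank exceeds \<open>n * u\<close>, the set
        \<open>a\<close> has at least \<open>n * u - 1\<close> elements; this is the source of the
        summand 1 in the claim.\<close>
      define i where "i = arg_min_on x (b - a)"
      have "finite (b - a)" using fin by simp
      note i = arg_min_if_finite[OF this False, of x, folded i_def]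
      define T where "T = {j\<in>{1..n}. x j \<le> x i}"
      have "T - {i} \<subseteq> a"
      proof
        fix j assume j: "j \<in> T - {i}"
        then have ji: "j \<in> {1..n}" "j \<noteq> i" "x j \<le> x i" by (auto simp: T_def)
        moreover have "i \<in> {1..n}" "x i \<le> s" using i(1) by (auto simp: b_def)
        ultimately have "x j < x i" "j \<in> b"
          using inj_onD[OF inj, of j i] by (force, simp add: b_def)
        then show "j \<in> a" using i(2) by blast
      qed
      then have "card (T - {i}) \<le> card a" using fin by (intro card_mono) auto
      then have "card T \<le> card a + 1"
        by (simp add: card_Diff_singleton_if split: if_splits)
      moreover have "real n * u \<le> real (card T)"
        using i(1) unfolding T_def emp_cdf_eq_card[symmetric]
        by (intro mult_left_mono) (auto simp: a_def b_def)
      ultimately have "real n * u - 1 \<le> real (card a)" by linarith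
      moreover have "(a - b) \<union> (b - a) = b - a" using sub by auto
      ultimately show ?thesis
        using \<open>\<not> emp_cdf n x s \<le> u\<close> card_mono[OF fin(2) sub] unfolding sum_eq
        by (simp add: card_Diff_subset[OF fin(1) sub] card_b right_diff_distrib)
    qed
  qed
qed

text \<open>For values 0 and 1, a difference of products is bounded by the sum of the differences of
  the factors. Each margin then contributes a rank error of \<open>1 / n\<close>.\<close>

lemma emp_copula_vs_emp_joint_cdf:
  assumes "inj_on x {1..n}" "inj_on y {1..n}" "0 \<le> u" "0 \<le> v" "n \<ge> 1"
  shows "\<bar>emp_copula n x y u v - emp_joint_cdf n x y s t\<bar>
    \<le> \<bar>emp_cdf n x s - u\<bar> + \<bar>emp_cdf n y t - v\<bar> + 2 / real n"
proof -
  let ?a = "\<lambda>j. of_bool (emp_cdf n x (x j) \<le> u) :: real" and ?b = "\<lambda>j. of_bool (x j \<le> s) :: real"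
  let ?c = "\<lambda>j. of_bool (emp_cdf n y (y j) \<le> v) :: real" and ?d = "\<lambda>j. of_bool (y j \<le> t) :: real"
  have "\<bar>emp_copula n x y u v - emp_joint_cdf n x y s t\<bar>
    = \<bar>\<Sum>j=1..n. ?a j * ?c j - ?b j * ?d j\<bar> / real n"
    by (simp add: emp_copula_def emp_joint_cdf_def sum_subtractf diff_divide_distrib[symmetric])
  also have "\<dots> \<le> (\<Sum>j=1..n. \<bar>?a j - ?b j\<bar> + \<bar>?c j - ?d j\<bar>) / real n"
    by (intro divide_right_mono order_trans[OF sum_abs] sum_mono) auto
  also have "\<dots> \<le> ((real n * \<bar>emp_cdf n x s - u\<bar> + 1) + (real n * \<bar>emp_cdf n y t - v\<bar> + 1)) / real n"
    unfolding sum.distrib using assms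
    by (intro divide_right_mono add_mono rank_le_vs_sample_le) auto
  also have "\<dots> = \<bar>emp_cdf n x s - u\<bar> + \<bar>emp_cdf n y t - v\<bar> + 2 / real n"
    using \<open>n \<ge> 1\<close> by (simp add: field_simps)
  finally show ?thesis .
qed

section \<open>Copulas with continuous partial derivatives\<close>

lemma continuous_partials_has_derivative:
  assumes "continuous_partials C" "u \<in> {0<..<1}" "v \<in> {0<..<1}"
  shows "((\<lambda>(x, y). C x y) has_derivative (\<lambda>(s, t). h1 C u v * s + h2 C u v * t)) (at (u, v))"
proof -
  let ?I = "{0<..<1::real}"
  have d1: "((\<lambda>s. C s v) has_derivative (\<lambda>s. h1 C u v * s)) (at u within ?I)"
    using assms unfolding continuous_partials_def h1_def
    by (meson DERIV_deriv_iff_real_differentiable has_field_derivative_at_within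
        has_field_derivative_def)
  have d2: "((\<lambda>t. C x t) has_derivative blinfun_apply (blinfun_mult_right (h2 C x y))) (at y within ?I)"
    if "x \<in> ?I" "y \<in> ?I" for x y
  proof -
    have "((\<lambda>t. C x t) has_field_derivative h2 C x y) (at y within ?I)"
      using assms(1) that unfolding continuous_partials_def h2_def
      by (meson DERIV_deriv_iff_real_differentiable has_field_derivative_at_within)
    then show ?thesis
      by (simp add: has_field_derivative_def blinfun_mult_right.rep_eq)
  qed
  have op: "open (?I \<times> ?I)" by (intro open_Times) auto
  have "continuous_on (?I \<times> ?I) (\<lambda>(x, y). h2 C x y)"
    using assms(1) by (simp add: continuous_partials_def)
  then have "continuous_on (?I \<times> ?I) (\<lambda>z. blinfun_mult_right ((\<lambda>(x, y). h2 C x y) z))"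
    by (rule bounded_linear.continuous_on[OF bounded_linear_blinfun_mult_right])
  then have c: "continuous (at (u, v) within ?I \<times> ?I) (\<lambda>(x, y). blinfun_mult_right (h2 C x y))"
    using assms by (auto simp: continuous_on_eq_continuous_within split_beta')
  have "((\<lambda>(x, y). C x y) has_derivative
    (\<lambda>(tx, ty). h1 C u v * tx + blinfun_apply (blinfun_mult_right (h2 C u v)) ty))
    (at (u, v) within ?I \<times> ?I)"
    using assms by (intro has_derivative_partialsI[OF d1 d2 c]) auto
  moreover have "at (u, v) within ?I \<times> ?I = at (u, v)"
    using assms by (intro at_within_open op) auto
  ultimately show ?thesis
    by (simp add: blinfun_mult_right.rep_eq)
qed

text \<open>This is the derivative of \<open>C\<close> at \<open>(u, v)\<close> in direction
  \<open>(s, t)\<close>, with the difference quotient taken along the step sizes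
  \<open>1 / sqrt n\<close>.\<close>

lemma continuous_partials_sqrt_expansion:
  assumes "continuous_partials C" "u \<in> {0<..<1}" "v \<in> {0<..<1}"
  shows "(\<lambda>n. sqrt (real n) * (C (u + s / sqrt (real n)) (v + t / sqrt (real n)) - C u v))
    \<longlonglongrightarrow> h1 C u v * s + h2 C u v * t"
proof -
  let ?g = "\<lambda>\<tau>. (\<lambda>(x, y). C x y) (u + \<tau> * s, v + \<tau> * t)"
  have "((\<lambda>\<tau>. (u + \<tau> * s, v + \<tau> * t)) has_derivative (\<lambda>\<tau>. (\<tau> * s, \<tau> * t))) (at 0)"
    by (auto intro!: derivative_eq_intros)
  moreover have "((\<lambda>(x, y). C x y) has_derivative (\<lambda>(s, t). h1 C u v * s + h2 C u v * t))
    (at (u + 0 * s, v + 0 * t))"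
    using continuous_partials_has_derivative[OF assms] by simp
  ultimately have "(?g has_derivative (\<lambda>\<tau>. (\<lambda>(s, t). h1 C u v * s + h2 C u v * t) (\<tau> * s, \<tau> * t))) (at 0)"
    by (rule has_derivative_compose)
  then have "(?g has_field_derivative (h1 C u v * s + h2 C u v * t)) (at 0)"
    unfolding has_field_derivative_def
    by (rule has_derivative_eq_rhs) (auto simp: fun_eq_iff algebra_simps)
  then have "((\<lambda>\<tau>. (?g \<tau> - ?g 0) / \<tau>) \<longlongrightarrow> h1 C u v * s + h2 C u v * t) (at 0)"
    by (simp add: DERIV_def)
  moreover have "filterlim (\<lambda>n. 1 / sqrt (real n)) (at 0) sequentially"
    by real_asymp
  ultimately have "(\<lambda>n. (?g (1 / sqrt (real n)) - ?g 0) / (1 / sqrt (real n)))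
    \<longlonglongrightarrow> h1 C u v * s + h2 C u v * t"
    by (rule filterlim_compose)
  then show ?thesis
    by (simp add: mult.commute)
qed

section \<open>Existence of quantiles, and the tail coefficient as a derivative\<close>

lemma (in real_distribution) cdf_surj:
  assumes "continuous_on UNIV (cdf M)" "p \<in> {0<..<1}"
  obtains x where "cdf M x = p"
proof -
  have "\<forall>\<^sub>F x in at_bot. cdf M x < p"
    using assms(2) order_tendstoD(2)[OF cdf_lim_at_bot] by auto
  then obtain a where a: "cdf M a < p" by (auto dest: eventually_happens)
  have "\<forall>\<^sub>F x in at_top. cdf M x > p"
    using assms(2) order_tendstoD(1)[OF cdf_lim_at_top_prob] by auto
  then obtain b where b: "cdf M b > p" by (auto dest: eventually_happens)
  have "a \<le> b" using a b cdf_nondecreasing[of b a] by force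
  then have "\<exists>x\<ge>a. x \<le> b \<and> cdf M x = p"
    using a b by (intro IVT') (auto intro: continuous_on_subset[OF assms(1)])
  then show ?thesis using that by blast
qed

text \<open>Since \<open>C 0 0 = 0\<close>, the quotient \<open>C u u / u\<close> is the difference
  quotient of the diagonal at 0. Both coefficients are defined by description operators, so it is
  the existence of the limit that pins them down.\<close>

lemma copula_lower_tail_dep:
  assumes "copula C" and lim: "((\<lambda>u. C u u / u) \<longlongrightarrow> l) (at_right 0)"
  shows "lower_tail_dep C = l" "diag_deriv0 C = l"
proof -
  show "lower_tail_dep C = l"
    unfolding lower_tail_dep_def using lim by (intro tendsto_Lim) auto
  have "C 0 0 = 0" using assms(1) by (simp add: copula_def)
  then have "(diag_section C has_real_derivative l) (at_right 0)"
    using lim by (simp add: diag_section_def has_field_derivative_iff)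
  then have "(diag_section C has_vector_derivative l) (at_right 0)"
    by (simp add: has_real_derivative_iff_has_vector_derivative)
  then show "diag_deriv0 C = l"
    unfolding diag_deriv0_def
    by (intro vector_derivative_within) auto
qed

section \<open>Linearisation of the empirical copula\<close>

text \<open>Multiples of \<open>\<epsilon>\<close>, found by rounding \<open>r / \<epsilon>\<close>
  up. Finiteness lets pointwise limits and a finite union bound replace uniform control over all
  thresholds.\<close>

lemma finite_grid:
  fixes \<epsilon> K :: real
  assumes "\<epsilon> > 0"
  obtains S where "finite S" "\<And>r. \<bar>r\<bar> \<le> K \<Longrightarrow> \<exists>s\<in>S. r \<le> s \<and> s \<le> r + \<epsilon>"
proof
  let ?N = "\<lceil>K / \<epsilon>\<rceil> + 1"
  let ?S = "(\<lambda>m. \<epsilon> * of_int m) ` {- ?N..?N}"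
  show "finite ?S" by simp
  fix r assume r: "\<bar>r\<bar> \<le> K"
  let ?m = "\<lceil>r / \<epsilon>\<rceil>"
  have "r / \<epsilon> \<le> K / \<epsilon>" "- (K / \<epsilon>) \<le> r / \<epsilon>"
    using r assms by (auto simp: field_simps)
  then have "?m \<in> {- ?N..?N}"
    by (auto; linarith)
  moreover have "r \<le> \<epsilon> * ?m"
    using assms le_of_int_ceiling[of "r / \<epsilon>"] by (metis mult.commute pos_divide_le_eq)
  moreover have "\<epsilon> * ?m \<le> r + \<epsilon>"
    using mult_left_mono[OF of_int_ceiling_le_add_one[of "r / \<epsilon>"], of \<epsilon>] assms
    by (simp add: distrib_left)
  ultimately show "\<exists>s\<in>?S. r \<le> s \<and> s \<le> r + \<epsilon>" by blast
qed

section \<open>The sampling model, quadrant indicators and population quantiles\<close>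

locale copula_sample = prob_space M for M :: "'a measure" +
  fixes X Y :: "nat \<Rightarrow> 'a \<Rightarrow> real"
    and C :: "real \<Rightarrow> real \<Rightarrow> real"
    and \<alpha> :: real
  assumes indep_XY: "indep_vars (\<lambda>_. borel) (\<lambda>j \<omega>. (X j \<omega>, Y j \<omega>)) {1..}"
    and ident_XY: "\<And>j. j \<ge> 1 \<Longrightarrow>
      distr M borel (\<lambda>\<omega>. (X j \<omega>, Y j \<omega>)) = distr M borel (\<lambda>\<omega>. (X 1 \<omega>, Y 1 \<omega>))"
    and cont_X: "continuous_on UNIV (cdf (distr M borel (X 1)))"
    and cont_Y: "continuous_on UNIV (cdf (distr M borel (Y 1)))"
    and copula_C: "copula_of M (X 1) (Y 1) C"
    and partials_C: "continuous_partials C"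
    and \<alpha>: "\<alpha> \<in> {0<..<1}"
begin

sublocale iid_sample M borel "\<lambda>j \<omega>. (X j \<omega>, Y j \<omega>)"
  by unfold_locales (rule indep_XY, rule ident_XY)

lemma measurable_proj:
  "fst \<in> borel_measurable (borel :: (real \<times> real) measure)"
  "snd \<in> borel_measurable (borel :: (real \<times> real) measure)"
  by (intro borel_measurable_continuous_onI continuous_intros)+

lemma measurable_X [measurable]: "j \<ge> 1 \<Longrightarrow> X j \<in> borel_measurable M"
  using measurable_compose[OF measurable_P measurable_proj(1)] by simp

lemma measurable_Y [measurable]: "j \<ge> 1 \<Longrightarrow> Y j \<in> borel_measurable M"
  using measurable_compose[OF measurable_P measurable_proj(2)] by simp

abbreviation F :: "real \<Rightarrow> real" where "F \<equiv> cdf (distr M borel (X 1))"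
abbreviation G :: "real \<Rightarrow> real" where "G \<equiv> cdf (distr M borel (Y 1))"

text \<open>Indicators of half planes and quadrants as functions of one observed pair. Their
  empirical processes are the scaled errors of the marginal and joint empirical distribution
  functions.\<close>

definition IX :: "real \<Rightarrow> real \<times> real \<Rightarrow> real" where "IX s p = indicator {..s} (fst p)"
definition IY :: "real \<Rightarrow> real \<times> real \<Rightarrow> real" where "IY t p = indicator {..t} (snd p)"
definition IXY :: "real \<Rightarrow> real \<Rightarrow> real \<times> real \<Rightarrow> real" where "IXY s t p = IX s p * IY t p"

lemma measurable_I [measurable]:
  "IX s \<in> borel_measurable borel" "IY t \<in> borel_measurable borel" "IXY s t \<in> borel_measurable borel"
proof -
  have "(\<lambda>p::real\<times>real. indicator {..s} (fst p) :: real) \<in> borel_measurable borel"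
    "(\<lambda>p::real\<times>real. indicator {..t} (snd p) :: real) \<in> borel_measurable borel"
    unfolding borel_prod[symmetric] by measurable
  then show [measurable]: "IX s \<in> borel_measurable borel" "IY t \<in> borel_measurable borel"
    by (simp_all add: IX_def[abs_def] IY_def[abs_def])
  show "IXY s t \<in> borel_measurable borel"
    unfolding IXY_def[abs_def] by measurable
qed

lemma abs_I_le: "\<bar>IX s p\<bar> \<le> 1" "\<bar>IY t p\<bar> \<le> 1" "\<bar>IXY s t p\<bar> \<le> 1"
  by (auto simp: IX_def IY_def IXY_def indicator_def)

lemma I_simps: "IX s (x, y) = of_bool (x \<le> s)" "IY t (x, y) = of_bool (y \<le> t)"
  "IXY s t (x, y) = of_bool (x \<le> s) * of_bool (y \<le> t)"
  by (auto simp: IX_def IY_def IXY_def indicator_def)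

lemma mu_I: "mu (IX s) = F s" "mu (IY t) = G t" "mu (IXY s t) = C (F s) (G t)"
proof -
  have ind: "expectation (\<lambda>\<omega>. of_bool (Q \<omega>)) = prob {\<omega> \<in> space M. Q \<omega>}" for Q
  proof -
    have "expectation (\<lambda>\<omega>. of_bool (Q \<omega>)) = expectation (indicator {\<omega> \<in> space M. Q \<omega>})"
      by (intro Bochner_Integration.integral_cong) (auto simp: indicator_def)
    also have "\<dots> = prob ({\<omega> \<in> space M. Q \<omega>} \<inter> space M)"
      by (rule Bochner_Integration.integral_indicator)
    also have "{\<omega> \<in> space M. Q \<omega>} \<inter> space M = {\<omega> \<in> space M. Q \<omega>}"
      by auto
    finally show ?thesis .
  qed
  have [measurable]: "X 1 \<in> borel_measurable M" "Y 1 \<in> borel_measurable M" by auto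
  show "mu (IX s) = F s" "mu (IY t) = G t"
    unfolding mu_def I_simps ind cdf_def
    by (subst measure_distr; force intro!: arg_cong[where f = prob])+
  have "mu (IXY s t) = joint_cdf M (X 1) (Y 1) s t"
    unfolding mu_def I_simps of_bool_conj[symmetric] joint_cdf_def
    by (rule ind)
  then show "mu (IXY s t) = C (F s) (G t)"
    using copula_C by (simp add: copula_of_def)
qed

lemma emp_process_I:
  assumes "n \<ge> 1"
  shows "emp_process n (IX s) \<omega> = sqrt (real n) * (emp_cdf n (\<lambda>j. X j \<omega>) s - F s)"
    and "emp_process n (IY t) \<omega> = sqrt (real n) * (emp_cdf n (\<lambda>j. Y j \<omega>) t - G t)"
    and "emp_process n (IXY s t) \<omega> = sqrt (real n) *
      (emp_joint_cdf n (\<lambda>j. X j \<omega>) (\<lambda>j. Y j \<omega>) s t - C (F s) (G t))"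
proof -
  have *: "(z - real n * m) / sqrt (real n) = sqrt (real n) * (z / real n - m)" for z m
  proof -
    have "sqrt (real n) * (z / real n - m) = (real n / sqrt (real n)) * (z / real n - m)"
      by (simp add: real_div_sqrt)
    also have "\<dots> = (z - real n * m) / sqrt (real n)"
      using assms by (simp add: field_simps)
    finally show ?thesis ..
  qed
  show "emp_process n (IX s) \<omega> = sqrt (real n) * (emp_cdf n (\<lambda>j. X j \<omega>) s - F s)"
    "emp_process n (IY t) \<omega> = sqrt (real n) * (emp_cdf n (\<lambda>j. Y j \<omega>) t - G t)"
    "emp_process n (IXY s t) \<omega> = sqrt (real n) *
      (emp_joint_cdf n (\<lambda>j. X j \<omega>) (\<lambda>j. Y j \<omega>) s t - C (F s) (G t))"
    by (simp_all only: emp_process_def I_simps mu_I emp_cdf_def emp_joint_cdf_def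
        sum_subtractf sum_constant card_atLeastAtMost diff_Suc_1 *)
qed

text \<open>Where \<open>F\<close> is flat, the preimage of \<open>p\<close> is not unique. Any
  choice serves, since the later arguments use only \<open>F (qX p) = p\<close>.\<close>

definition qX :: "real \<Rightarrow> real" where "qX p = (SOME x. F x = p)"
definition qY :: "real \<Rightarrow> real" where "qY p = (SOME y. G y = p)"

lemma F_qX: "p \<in> {0<..<1} \<Longrightarrow> F (qX p) = p"
proof -
  assume p: "p \<in> {0<..<1}"
  interpret D: real_distribution "distr M borel (X 1)" by (rule real_distribution_distr) simp
  show "F (qX p) = p"
    unfolding qX_def using D.cdf_surj[OF cont_X p] by (rule someI_ex) blast
qed

lemma G_qY: "p \<in> {0<..<1} \<Longrightarrow> G (qY p) = p"
proof -
  assume p: "p \<in> {0<..<1}"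
  interpret D: real_distribution "distr M borel (Y 1)" by (rule real_distribution_distr) simp
  show "G (qY p) = p"
    unfolding qY_def using D.cdf_surj[OF cont_Y p] by (rule someI_ex) blast
qed

section \<open>Second moments of indicator increments\<close>

text \<open>Half planes are nested, so the difference of two indicators is, up to sign, again an
  indicator, and squaring it leaves the mass of the strip between them.\<close>

lemma mu_IX_diff: "mu (\<lambda>p. (IX s p - IX s' p)\<^sup>2) = \<bar>F s - F s'\<bar>"
  and mu_IY_diff: "mu (\<lambda>p. (IY t p - IY t' p)\<^sup>2) = \<bar>G t - G t'\<bar>"
proof -
  interpret X: real_distribution "distr M borel (X 1)" by (rule real_distribution_distr) simp
  interpret Y: real_distribution "distr M borel (Y 1)" by (rule real_distribution_distr) simp
  have int: "integrable M (\<lambda>\<omega>. IX s (X 1 \<omega>, Y 1 \<omega>))" "integrable M (\<lambda>\<omega>. IY s (X 1 \<omega>, Y 1 \<omega>))" for s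
    by (rule integrable_P[of _ 1 1]; simp add: abs_I_le)+
  have d: "mu (\<lambda>p. IX s p - IX s' p) = F s - F s'" "mu (\<lambda>p. IY s p - IY s' p) = G s - G s'" for s s'
    using int mu_I by (simp_all add: mu_def)
  have "mu (\<lambda>p. (IX s p - IX s' p)\<^sup>2) = \<bar>F s - F s'\<bar>" if "s' \<le> s" for s s'
  proof -
    have "(\<lambda>p. (IX s p - IX s' p)\<^sup>2) = (\<lambda>p. IX s p - IX s' p)"
      using that by (auto simp: fun_eq_iff IX_def indicator_def)
    then show ?thesis using d X.cdf_nondecreasing[OF that] by simp
  qed
  note le = this
  show "mu (\<lambda>p. (IX s p - IX s' p)\<^sup>2) = \<bar>F s - F s'\<bar>"
  proof (cases "s' \<le> s")
    case False
    have "(\<lambda>p. (IX s p - IX s' p)\<^sup>2) = (\<lambda>p. (IX s' p - IX s p)\<^sup>2)"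
      by (simp add: power2_commute)
    then show ?thesis using le[of s s'] False by (simp add: abs_minus_commute)
  qed (rule le)
  have "mu (\<lambda>p. (IY s p - IY s' p)\<^sup>2) = \<bar>G s - G s'\<bar>" if "s' \<le> s" for s s'
  proof -
    have "(\<lambda>p. (IY s p - IY s' p)\<^sup>2) = (\<lambda>p. IY s p - IY s' p)"
      using that by (auto simp: fun_eq_iff IY_def indicator_def)
    then show ?thesis using d Y.cdf_nondecreasing[OF that] by simp
  qed
  note le = this
  show "mu (\<lambda>p. (IY t p - IY t' p)\<^sup>2) = \<bar>G t - G t'\<bar>"
  proof (cases "t' \<le> t")
    case False
    have "(\<lambda>p. (IY t p - IY t' p)\<^sup>2) = (\<lambda>p. (IY t' p - IY t p)\<^sup>2)"
      by (simp add: power2_commute)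
    then show ?thesis using le[of t t'] False by (simp add: abs_minus_commute)
  qed (rule le)
qed

text \<open>Two quadrants can differ only at points where one of the bounding half planes differs,
  which bounds the squares pointwise.\<close>

lemma mu_IXY_diff: "mu (\<lambda>p. (IXY s t p - IXY s' t' p)\<^sup>2) \<le> \<bar>F s - F s'\<bar> + \<bar>G t - G t'\<bar>"
proof -
  have le: "(IXY s t p - IXY s' t' p)\<^sup>2 \<le> (IX s p - IX s' p)\<^sup>2 + (IY t p - IY t' p)\<^sup>2"
    and sq: "\<bar>(IXY s t p - IXY s' t' p)\<^sup>2\<bar> \<le> 1" "\<bar>(IX s p - IX s' p)\<^sup>2\<bar> \<le> 1"
    "\<bar>(IY t p - IY t' p)\<^sup>2\<bar> \<le> 1" for p
    by (cases "fst p \<le> s"; cases "fst p \<le> s'"; cases "snd p \<le> t"; cases "snd p \<le> t'";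
        simp add: IX_def IY_def IXY_def)+
  have int: "integrable M (\<lambda>\<omega>. (IXY s t (X 1 \<omega>, Y 1 \<omega>) - IXY s' t' (X 1 \<omega>, Y 1 \<omega>))\<^sup>2)"
    "integrable M (\<lambda>\<omega>. (IX s (X 1 \<omega>, Y 1 \<omega>) - IX s' (X 1 \<omega>, Y 1 \<omega>))\<^sup>2)"
    "integrable M (\<lambda>\<omega>. (IY t (X 1 \<omega>, Y 1 \<omega>) - IY t' (X 1 \<omega>, Y 1 \<omega>))\<^sup>2)"
    using sq integrable_P[of "\<lambda>p. (IXY s t p - IXY s' t' p)\<^sup>2" 1 1]
      integrable_P[of "\<lambda>p. (IX s p - IX s' p)\<^sup>2" 1 1]
      integrable_P[of "\<lambda>p. (IY t p - IY t' p)\<^sup>2" 1 1] by auto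
  have "mu (\<lambda>p. (IXY s t p - IXY s' t' p)\<^sup>2)
    \<le> mu (\<lambda>p. (IX s p - IX s' p)\<^sup>2 + (IY t p - IY t' p)\<^sup>2)"
    unfolding mu_def using int by (intro integral_mono le) auto
  also have "\<dots> = mu (\<lambda>p. (IX s p - IX s' p)\<^sup>2) + mu (\<lambda>p. (IY t p - IY t' p)\<^sup>2)"
    unfolding mu_def using int by simp
  finally show ?thesis by (simp add: mu_IX_diff mu_IY_diff)
qed

section \<open>The remainder, its measurability, and absence of ties\<close>

text \<open>The variable \<open>R_n\<close> of the overview; the plus signs come from moving
  \<open>- h1 * A - h2 * B\<close> to the other side.\<close>

definition remainder :: "nat \<Rightarrow> 'a \<Rightarrow> real" where
  "remainder n \<omega> = sqrt (real n) * (emp_copula n (\<lambda>j. X j \<omega>) (\<lambda>j. Y j \<omega>) \<alpha> \<alpha> - C \<alpha> \<alpha>)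
    - emp_process n (IXY (qX \<alpha>) (qY \<alpha>)) \<omega>
    + h1 C \<alpha> \<alpha> * emp_process n (IX (qX \<alpha>)) \<omega>
    + h2 C \<alpha> \<alpha> * emp_process n (IY (qY \<alpha>)) \<omega>"

lemma measurable_emp_copula [measurable]:
  "(\<lambda>\<omega>. emp_copula n (\<lambda>j. X j \<omega>) (\<lambda>j. Y j \<omega>) u v) \<in> borel_measurable M"
proof -
  have cdf: "(\<lambda>\<omega>. emp_cdf n (\<lambda>i. Z i \<omega>) (Z j \<omega>)) \<in> borel_measurable M"
    if "\<And>i. i \<ge> 1 \<Longrightarrow> Z i \<in> borel_measurable M" "j \<ge> 1" for Z :: "nat \<Rightarrow> 'a \<Rightarrow> real" and j
    unfolding emp_cdf_def of_bool_def using that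
    by (intro borel_measurable_divide borel_measurable_sum borel_measurable_const measurable_If
        borel_measurable_le) auto
  show ?thesis
    unfolding emp_copula_def of_bool_def
    by (intro borel_measurable_divide borel_measurable_sum borel_measurable_times
        borel_measurable_const measurable_If borel_measurable_le cdf) auto
qed

lemma measurable_remainder [measurable]: "remainder n \<in> borel_measurable M"
  unfolding remainder_def[abs_def] by measurable

text \<open>Distinct observations are independent with continuous margins, so each of the finitely
  many possible ties has probability zero.\<close>

lemma AE_inj_on: "AE \<omega> in M. inj_on (\<lambda>j. X j \<omega>) {1..n} \<and> inj_on (\<lambda>j. Y j \<omega>) {1..n}"
proof -
  have f_XY: "distr M borel (\<lambda>\<omega>. f (X j \<omega>, Y j \<omega>)) = distr M borel (\<lambda>\<omega>. f (X 1 \<omega>, Y 1 \<omega>))"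
    if f: "f \<in> borel_measurable borel" and "j \<ge> 1" for f :: "real \<times> real \<Rightarrow> real" and j
  proof -
    have "distr M borel (\<lambda>\<omega>. f (X k \<omega>, Y k \<omega>)) = distr (distr M borel (\<lambda>\<omega>. (X k \<omega>, Y k \<omega>))) borel f"
      if "k \<ge> 1" for k
      using distr_distr[OF f measurable_P[OF that]] by (simp add: comp_def)
    then show ?thesis using ident_XY[OF \<open>j \<ge> 1\<close>] \<open>j \<ge> 1\<close> by simp
  qed
  have XY: "distr M borel (X j) = distr M borel (X 1)" "distr M borel (Y j) = distr M borel (Y 1)"
    if "j \<ge> 1" for j
    using f_XY[of fst j] f_XY[of snd j] that
    by (simp_all add: measurable_proj)
  have null: "measure (distr M borel (X j)) {x} = 0" "measure (distr M borel (Y j)) {x} = 0"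
    if "j \<ge> 1" for j x
  proof -
    interpret X: real_distribution "distr M borel (X 1)" by (rule real_distribution_distr) simp
    interpret Y: real_distribution "distr M borel (Y 1)" by (rule real_distribution_distr) simp
    show "measure (distr M borel (X j)) {x} = 0" "measure (distr M borel (Y j)) {x} = 0"
      using XY[OF that] X.isCont_cdf[of x] Y.isCont_cdf[of x] cont_X cont_Y
      by (auto simp: continuous_on_eq_continuous_at)
  qed
  have indep_X: "indep_vars (\<lambda>_. borel) X {1..}" and indep_Y: "indep_vars (\<lambda>_. borel) Y {1..}"
    using indep_vars_compose2[OF indep_XY, of "\<lambda>_. fst" "\<lambda>_. borel"]
      indep_vars_compose2[OF indep_XY, of "\<lambda>_. snd" "\<lambda>_. borel"]
    by (simp_all add: measurable_proj)
  have neq: "AE \<omega> in M. i \<noteq> j \<longrightarrow> X i \<omega> \<noteq> X j \<omega> \<and> Y i \<omega> \<noteq> Y j \<omega>"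
    if "i \<in> {1..n}" "j \<in> {1..n}" for i j
  proof (cases "i = j")
    case False
    have sub: "insert i {j} \<subseteq> {1..}" using that by auto
    have "indep_var borel (X i) borel (X j)" "indep_var borel (Y i) borel (Y j)"
      using False indep_vars_sum[OF _ _ indep_vars_subset[OF indep_X sub]]
        indep_vars_sum[OF _ _ indep_vars_subset[OF indep_Y sub]] by simp_all
    then have "AE \<omega> in M. X i \<omega> \<noteq> X j \<omega>" "AE \<omega> in M. Y i \<omega> \<noteq> Y j \<omega>"
      using null that by (simp_all add: indep_continuous_AE_neq)
    then show ?thesis by eventually_elim simp
  qed simp
  have "AE \<omega> in M. \<forall>i\<in>{1..n}. \<forall>j\<in>{1..n}. i \<noteq> j \<longrightarrow> X i \<omega> \<noteq> X j \<omega> \<and> Y i \<omega> \<noteq> Y j \<omega>"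
    by (intro AE_finite_allI neq finite_atLeastAtMost)
  then show ?thesis
    by eventually_elim (auto simp: inj_on_def)
qed

section \<open>Convergence of the remainder to zero in probability\<close>

lemma emp_process_I_diff:
  "emp_process n (\<lambda>p. IX s p - IX s' p) \<omega> = emp_process n (IX s) \<omega> - emp_process n (IX s') \<omega>"
  "emp_process n (\<lambda>p. IY t p - IY t' p) \<omega> = emp_process n (IY t) \<omega> - emp_process n (IY t') \<omega>"
  "emp_process n (\<lambda>p. IXY s t p - IXY s' t' p) \<omega>
    = emp_process n (IXY s t) \<omega> - emp_process n (IXY s' t') \<omega>"
  by (rule emp_process_diff measurable_I abs_I_le)+

text \<open>The squeeze for one fixed outcome; everything random has been moved into the hypotheses.
  In the final constant, 2 counts the errors of the joint increment and of the expansion of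
  \<open>C\<close>, and each 3 comes from replacing \<open>- A\<close> or \<open>- B\<close> by a
  grid point at distance at most \<open>3 * \<epsilon>\<close>.\<close>

lemma remainder_le:
  fixes \<epsilon> T :: real and S :: "real set" and \<omega> :: 'a
  defines "qXn \<equiv> \<lambda>n s. qX (\<alpha> + s / sqrt (real n))" and "qYn \<equiv> \<lambda>n s. qY (\<alpha> + s / sqrt (real n))"
  assumes n: "n \<ge> 1" and "\<epsilon> > 0"
    and range: "\<And>s. s \<in> S \<Longrightarrow> \<alpha> + s / sqrt (real n) \<in> {0<..<1}"
    and cover: "\<And>r. \<bar>r\<bar> \<le> T + 2 * \<epsilon> \<Longrightarrow> \<exists>s\<in>S. r \<le> s \<and> s \<le> r + \<epsilon>"
    and bound: "\<bar>emp_process n (IX (qX \<alpha>)) \<omega>\<bar> \<le> T" "\<bar>emp_process n (IY (qY \<alpha>)) \<omega>\<bar> \<le> T"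
    and inc: "\<And>s. s \<in> S \<Longrightarrow> \<bar>emp_process n (\<lambda>p. IX (qXn n s) p - IX (qX \<alpha>) p) \<omega>\<bar> < \<epsilon>"
      "\<And>t. t \<in> S \<Longrightarrow> \<bar>emp_process n (\<lambda>p. IY (qYn n t) p - IY (qY \<alpha>) p) \<omega>\<bar> < \<epsilon>"
      "\<And>s t. s \<in> S \<Longrightarrow> t \<in> S \<Longrightarrow>
        \<bar>emp_process n (\<lambda>p. IXY (qXn n s) (qYn n t) p - IXY (qX \<alpha>) (qY \<alpha>) p) \<omega>\<bar> < \<epsilon>"
    and taylor: "\<And>s t. s \<in> S \<Longrightarrow> t \<in> S \<Longrightarrow>
      \<bar>sqrt (real n) * (C (\<alpha> + s / sqrt (real n)) (\<alpha> + t / sqrt (real n)) - C \<alpha> \<alpha>)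
        - (h1 C \<alpha> \<alpha> * s + h2 C \<alpha> \<alpha> * t)\<bar> < \<epsilon>"
  shows "\<bar>remainder n \<omega>\<bar> \<le> (2 + 3 * \<bar>h1 C \<alpha> \<alpha>\<bar> + 3 * \<bar>h2 C \<alpha> \<alpha>\<bar>) * \<epsilon>"
proof -
  define A B D where "A = emp_process n (IX (qX \<alpha>)) \<omega>" and "B = emp_process n (IY (qY \<alpha>)) \<omega>"
    and "D = emp_process n (IXY (qX \<alpha>) (qY \<alpha>)) \<omega>"
  define a b where "a = h1 C \<alpha> \<alpha>" and "b = h2 C \<alpha> \<alpha>"
  define x y where "x = (\<lambda>j. X j \<omega>)" and "y = (\<lambda>j. Y j \<omega>)"
  define w where "w = sqrt (real n)"
  have w: "w > 0" using n by (simp add: w_def)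
  \<comment> \<open>Shifting the quantile level by \<open>s / sqrt n\<close> moves the scaled error
    of the empirical margin from \<open>A\<close> to \<open>A + s\<close>, up to the increment of
    the process.\<close>
  have margX: "\<bar>w * (emp_cdf n x (qXn n s) - \<alpha>) - (A + s)\<bar> < \<epsilon>" if "s \<in> S" for s
  proof -
    have "emp_process n (IX (qXn n s)) \<omega> = w * (emp_cdf n x (qXn n s) - (\<alpha> + s / w))"
      using emp_process_I(1)[OF n] F_qX[OF range[OF that]] by (simp add: qXn_def x_def w_def)
    also have "\<dots> = w * (emp_cdf n x (qXn n s) - \<alpha>) - s"
      using w by (simp add: field_simps)
    finally show ?thesis
      using inc(1)[OF that] unfolding emp_process_I_diff A_def by (simp add: algebra_simps)
  qed
  have margY: "\<bar>w * (emp_cdf n y (qYn n t) - \<alpha>) - (B + t)\<bar> < \<epsilon>" if "t \<in> S" for t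
  proof -
    have "emp_process n (IY (qYn n t)) \<omega> = w * (emp_cdf n y (qYn n t) - (\<alpha> + t / w))"
      using emp_process_I(2)[OF n] G_qY[OF range[OF that]] by (simp add: qYn_def y_def w_def)
    also have "\<dots> = w * (emp_cdf n y (qYn n t) - \<alpha>) - t"
      using w by (simp add: field_simps)
    finally show ?thesis
      using inc(2)[OF that] unfolding emp_process_I_diff B_def by (simp add: algebra_simps)
  qed
  have joint: "\<bar>w * (emp_joint_cdf n x y (qXn n s) (qYn n t) - C \<alpha> \<alpha>) - (D - a * A - b * B)\<bar>
      \<le> (2 + 3 * \<bar>a\<bar> + 3 * \<bar>b\<bar>) * \<epsilon>"
    if "s \<in> S" "t \<in> S" "\<bar>A + s\<bar> \<le> 3 * \<epsilon>" "\<bar>B + t\<bar> \<le> 3 * \<epsilon>" for s t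
  proof -
    let ?c = "C (\<alpha> + s / w) (\<alpha> + t / w)"
    have "emp_process n (IXY (qXn n s) (qYn n t)) \<omega>
      = w * (emp_joint_cdf n x y (qXn n s) (qYn n t) - ?c)"
      using emp_process_I(3)[OF n] F_qX[OF range] G_qY[OF range] that
      by (simp add: qXn_def qYn_def x_def y_def w_def)
    then have e1: "\<bar>w * (emp_joint_cdf n x y (qXn n s) (qYn n t) - ?c) - D\<bar> < \<epsilon>"
      using inc(3)[OF that(1,2)] unfolding emp_process_I_diff D_def by simp
    have e2: "\<bar>w * (?c - C \<alpha> \<alpha>) - (a * s + b * t)\<bar> < \<epsilon>"
      using taylor[OF that(1,2)] by (simp add: w_def a_def b_def)
    have e3: "\<bar>a * (A + s)\<bar> \<le> \<bar>a\<bar> * (3 * \<epsilon>)" "\<bar>b * (B + t)\<bar> \<le> \<bar>b\<bar> * (3 * \<epsilon>)"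
      unfolding abs_mult using that(3,4) by (intro mult_left_mono; simp)+
    \<comment> \<open>Telescoping: the increment of the joint process, the expansion of
      \<open>C\<close>, and the exchange of \<open>s\<close>, \<open>t\<close> for
      \<open>- A\<close>, \<open>- B\<close> in its linear part.\<close>
    have "w * (emp_joint_cdf n x y (qXn n s) (qYn n t) - C \<alpha> \<alpha>) - (D - a * A - b * B)
      = (w * (emp_joint_cdf n x y (qXn n s) (qYn n t) - ?c) - D)
        + (w * (?c - C \<alpha> \<alpha>) - (a * s + b * t)) + a * (A + s) + b * (B + t)"
      by (simp add: algebra_simps)
    then have "\<bar>w * (emp_joint_cdf n x y (qXn n s) (qYn n t) - C \<alpha> \<alpha>) - (D - a * A - b * B)\<bar>
      \<le> \<epsilon> + \<epsilon> + \<bar>a\<bar> * (3 * \<epsilon>) + \<bar>b\<bar> * (3 * \<epsilon>)"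
      using e1 e2 e3 by linarith
    then show ?thesis by (simp add: algebra_simps)
  qed
  have rem: "remainder n \<omega> = w * (emp_copula n x y \<alpha> \<alpha> - C \<alpha> \<alpha>) - (D - a * A - b * B)"
    by (simp add: remainder_def w_def x_def y_def a_def b_def A_def B_def D_def)
  have AB: "\<bar>A\<bar> \<le> T" "\<bar>B\<bar> \<le> T" using bound by (auto simp: A_def B_def)
  \<comment> \<open>The offset \<open>2 * \<epsilon>\<close> outweighs the error
    \<open>\<epsilon>\<close> in \<open>margX\<close> and \<open>margY\<close>, so both empirical
    margins lie strictly above \<alpha>. The range \<open>T + 2 * \<epsilon>\<close> of the grid is
    chosen to reach these points.\<close>
  obtain s where s: "s \<in> S" "- A + 2 * \<epsilon> \<le> s" "s \<le> - A + 2 * \<epsilon> + \<epsilon>"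
    using cover[of "- A + 2 * \<epsilon>"] AB \<open>\<epsilon> > 0\<close> by force
  obtain t where t: "t \<in> S" "- B + 2 * \<epsilon> \<le> t" "t \<le> - B + 2 * \<epsilon> + \<epsilon>"
    using cover[of "- B + 2 * \<epsilon>"] AB \<open>\<epsilon> > 0\<close> by force
  have "0 < w * (emp_cdf n x (qXn n s) - \<alpha>)" "0 < w * (emp_cdf n y (qYn n t) - \<alpha>)"
    using margX[OF s(1)] margY[OF t(1)] s t \<open>\<epsilon> > 0\<close> by linarith+
  then have "emp_copula n x y \<alpha> \<alpha> \<le> emp_joint_cdf n x y (qXn n s) (qYn n t)"
    using w by (intro emp_copula_le_emp_joint_cdf) (auto simp: zero_less_mult_iff)
  then have "w * (emp_copula n x y \<alpha> \<alpha> - C \<alpha> \<alpha>) \<le> w * (emp_joint_cdf n x y (qXn n s) (qYn n t) - C \<alpha> \<alpha>)"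
    using w by (intro mult_left_mono) auto
  moreover have "\<bar>A + s\<bar> \<le> 3 * \<epsilon>" "\<bar>B + t\<bar> \<le> 3 * \<epsilon>" using s t \<open>\<epsilon> > 0\<close> by linarith+
  ultimately have upper: "remainder n \<omega> \<le> (2 + 3 * \<bar>a\<bar> + 3 * \<bar>b\<bar>) * \<epsilon>"
    using joint[OF s(1) t(1)] unfolding rem by linarith
  \<comment> \<open>The mirrored offset puts both empirical margins below \<alpha>, as the lower
    half of the squeeze requires.\<close>
  obtain s' where s': "s' \<in> S" "- A - 2 * \<epsilon> \<le> s'" "s' \<le> - A - 2 * \<epsilon> + \<epsilon>"
    using cover[of "- A - 2 * \<epsilon>"] AB \<open>\<epsilon> > 0\<close> by force
  obtain t' where t': "t' \<in> S" "- B - 2 * \<epsilon> \<le> t'" "t' \<le> - B - 2 * \<epsilon> + \<epsilon>"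
    using cover[of "- B - 2 * \<epsilon>"] AB \<open>\<epsilon> > 0\<close> by force
  have "w * (emp_cdf n x (qXn n s') - \<alpha>) < 0" "w * (emp_cdf n y (qYn n t') - \<alpha>) < 0"
    using margX[OF s'(1)] margY[OF t'(1)] s' t' \<open>\<epsilon> > 0\<close> by linarith+
  then have "emp_joint_cdf n x y (qXn n s') (qYn n t') \<le> emp_copula n x y \<alpha> \<alpha>"
    using w by (intro emp_joint_cdf_le_emp_copula) (auto simp: mult_less_0_iff)
  then have "w * (emp_joint_cdf n x y (qXn n s') (qYn n t') - C \<alpha> \<alpha>) \<le> w * (emp_copula n x y \<alpha> \<alpha> - C \<alpha> \<alpha>)"
    using w by (intro mult_left_mono) auto
  moreover have "\<bar>A + s'\<bar> \<le> 3 * \<epsilon>" "\<bar>B + t'\<bar> \<le> 3 * \<epsilon>" using s' t' \<open>\<epsilon> > 0\<close> by linarith+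
  ultimately have "- ((2 + 3 * \<bar>a\<bar> + 3 * \<bar>b\<bar>) * \<epsilon>) \<le> remainder n \<omega>"
    using joint[OF s'(1) t'(1)] unfolding rem by linarith
  with upper show ?thesis by (simp add: a_def b_def)
qed

text \<open>A large remainder violates a hypothesis of \<open>remainder_le\<close>, so a union bound
  with Chebyshev applies. The two marginal processes cost \<open>1 / T^2\<close> each. The
  increments have second moments of order \<open>1 / sqrt n\<close>, and \<open>K\<close> collects
  their constants over a grid that does not depend on \<open>n\<close>.\<close>

lemma remainder_prob_bound:
  assumes "\<kappa> > 0" "T > 0"
  obtains K where "\<forall>\<^sub>F n in sequentially.
    prob {\<omega> \<in> space M. \<bar>remainder n \<omega>\<bar> > \<kappa>} \<le> 2 / T\<^sup>2 + K / sqrt (real n)"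
proof -
  define c where "c = 2 + 3 * \<bar>h1 C \<alpha> \<alpha>\<bar> + 3 * \<bar>h2 C \<alpha> \<alpha>\<bar>"
  have c: "c > 0" by (auto simp: c_def intro: add_pos_nonneg)
  \<comment> \<open>Makes the bound of \<open>remainder_le\<close> exactly
    \<open>\<kappa>\<close>.\<close>
  define \<epsilon> where "\<epsilon> = \<kappa> / c"
  have \<epsilon>: "\<epsilon> > 0" "c * \<epsilon> = \<kappa>" using c \<open>\<kappa> > 0\<close> by (auto simp: \<epsilon>_def)
  obtain S where S: "finite S" "\<And>r. \<bar>r\<bar> \<le> T + 2 * \<epsilon> \<Longrightarrow> \<exists>s\<in>S. r \<le> s \<and> s \<le> r + \<epsilon>"
    using finite_grid[OF \<epsilon>(1)] by blast
  define dX dY dXY where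
    "dX = (\<lambda>n s p. IX (qX (\<alpha> + s / sqrt (real n))) p - IX (qX \<alpha>) p)" and
    "dY = (\<lambda>n t p. IY (qY (\<alpha> + t / sqrt (real n))) p - IY (qY \<alpha>) p)" and
    "dXY = (\<lambda>n s t p. IXY (qX (\<alpha> + s / sqrt (real n))) (qY (\<alpha> + t / sqrt (real n))) p
       - IXY (qX \<alpha>) (qY \<alpha>) p)"
  have meas [measurable]: "dX n s \<in> borel_measurable borel" "dY n s \<in> borel_measurable borel"
    "dXY n s t \<in> borel_measurable borel" for n s t
    by (simp_all add: dX_def dY_def dXY_def)
  have abs2: "\<bar>u - v\<bar> \<le> 2" if "\<bar>u\<bar> \<le> 1" "\<bar>v\<bar> \<le> 1" for u v :: real
    using that by linarith
  have bd: "\<bar>dX n s p\<bar> \<le> 2" "\<bar>dY n s p\<bar> \<le> 2" "\<bar>dXY n s t p\<bar> \<le> 2" for n s t p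
    unfolding dX_def dY_def dXY_def by (intro abs2 abs_I_le)+
  define Q where "Q = (\<lambda>f n \<omega>. (emp_process n f \<omega>)\<^sup>2)"
  have int: "integrable M (Q (IX s) n)" "integrable M (Q (IY s) n)"
    "integrable M (Q (dX n s) n)" "integrable M (Q (dY n s) n)" "integrable M (Q (dXY n s t) n)" for n s t
    unfolding Q_def
    by (rule integrable_emp_process_power[OF measurable_I(1) abs_I_le(1)]
        integrable_emp_process_power[OF measurable_I(2) abs_I_le(2)]
        integrable_emp_process_power[OF meas(1) bd(1)] integrable_emp_process_power[OF meas(2) bd(2)]
        integrable_emp_process_power[OF meas(3) bd(3)])+
  \<comment> \<open>One Chebyshev term for each stochastic hypothesis of \<open>remainder_le\<close>
    that may fail. The sum is at least 1 whenever the remainder exceeds \<open>\<kappa>\<close>, so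
    it dominates the indicator of that event and can be integrated term by term.\<close>
  define rhs where "rhs = (\<lambda>n \<omega>. Q (IX (qX \<alpha>)) n \<omega> / T\<^sup>2 + Q (IY (qY \<alpha>)) n \<omega> / T\<^sup>2
    + (\<Sum>s\<in>S. Q (dX n s) n \<omega> / \<epsilon>\<^sup>2) + (\<Sum>t\<in>S. Q (dY n t) n \<omega> / \<epsilon>\<^sup>2)
    + (\<Sum>s\<in>S. \<Sum>t\<in>S. Q (dXY n s t) n \<omega> / \<epsilon>\<^sup>2))"
  define K where "K = (\<Sum>s\<in>S. \<bar>s\<bar> / \<epsilon>\<^sup>2) + (\<Sum>t\<in>S. \<bar>t\<bar> / \<epsilon>\<^sup>2) + (\<Sum>s\<in>S. \<Sum>t\<in>S. (\<bar>s\<bar> + \<bar>t\<bar>) / \<epsilon>\<^sup>2)"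
  have rhs_nonneg: "0 \<le> rhs n \<omega>" for n \<omega>
    unfolding rhs_def Q_def by (intro add_nonneg_nonneg sum_nonneg divide_nonneg_nonneg) auto
  have int_rhs: "integrable M (rhs n)" for n
    unfolding rhs_def by (intro Bochner_Integration.integrable_add Bochner_Integration.integrable_sum
        integrable_divide int)
  have main: "prob {\<omega> \<in> space M. \<bar>remainder n \<omega>\<bar> > \<kappa>} \<le> 2 / T\<^sup>2 + K / sqrt (real n)"
    if n: "n \<ge> 1" and range: "\<forall>s\<in>S. \<alpha> + s / sqrt (real n) \<in> {0<..<1}"
      and taylor: "\<forall>s\<in>S. \<forall>t\<in>S.
        \<bar>sqrt (real n) * (C (\<alpha> + s / sqrt (real n)) (\<alpha> + t / sqrt (real n)) - C \<alpha> \<alpha>)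
          - (h1 C \<alpha> \<alpha> * s + h2 C \<alpha> \<alpha> * t)\<bar> < \<epsilon>" for n
  proof -
    have ge1: "1 \<le> Q f n \<omega> / r\<^sup>2" if "r \<le> \<bar>emp_process n f \<omega>\<bar>" "r > 0" for f \<omega> r
      using power_mono[OF that(1), of 2] that(2) by (simp add: Q_def)
    have rhs_ge: "1 \<le> rhs n \<omega>" if large: "\<bar>remainder n \<omega>\<bar> > \<kappa>" for \<omega>
    proof -
      have nonneg: "0 \<le> Q f n \<omega> / r\<^sup>2" for f r by (simp add: Q_def)
      have "\<not> \<bar>emp_process n (IX (qX \<alpha>)) \<omega>\<bar> \<le> T \<or> \<not> \<bar>emp_process n (IY (qY \<alpha>)) \<omega>\<bar> \<le> T
        \<or> (\<exists>s\<in>S. \<not> \<bar>emp_process n (dX n s) \<omega>\<bar> < \<epsilon>) \<or> (\<exists>t\<in>S. \<not> \<bar>emp_process n (dY n t) \<omega>\<bar> < \<epsilon>)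
        \<or> (\<exists>s\<in>S. \<exists>t\<in>S. \<not> \<bar>emp_process n (dXY n s t) \<omega>\<bar> < \<epsilon>)"
      proof (rule ccontr)
        assume "\<not> ?thesis"
        then have "\<bar>remainder n \<omega>\<bar> \<le> c * \<epsilon>"
          unfolding c_def using n \<epsilon>(1) range taylor S(2)
          by (intro remainder_le[where T = T and S = S]) (auto simp: dX_def dY_def dXY_def)
        then show False using large \<epsilon>(2) by simp
      qed
      then consider (1) "T \<le> \<bar>emp_process n (IX (qX \<alpha>)) \<omega>\<bar>" | (2) "T \<le> \<bar>emp_process n (IY (qY \<alpha>)) \<omega>\<bar>"
        | (3) s where "s \<in> S" "\<epsilon> \<le> \<bar>emp_process n (dX n s) \<omega>\<bar>"
        | (4) t where "t \<in> S" "\<epsilon> \<le> \<bar>emp_process n (dY n t) \<omega>\<bar>"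
        | (5) s t where "s \<in> S" "t \<in> S" "\<epsilon> \<le> \<bar>emp_process n (dXY n s t) \<omega>\<bar>"
        by (auto simp: not_less not_le intro: less_imp_le)
      then have "1 \<le> Q (IX (qX \<alpha>)) n \<omega> / T\<^sup>2 \<or> 1 \<le> Q (IY (qY \<alpha>)) n \<omega> / T\<^sup>2
        \<or> 1 \<le> (\<Sum>s\<in>S. Q (dX n s) n \<omega> / \<epsilon>\<^sup>2) \<or> 1 \<le> (\<Sum>t\<in>S. Q (dY n t) n \<omega> / \<epsilon>\<^sup>2)
        \<or> 1 \<le> (\<Sum>s\<in>S. \<Sum>t\<in>S. Q (dXY n s t) n \<omega> / \<epsilon>\<^sup>2)"
      proof cases
        case 3
        have "Q (dX n s) n \<omega> / \<epsilon>\<^sup>2 \<le> (\<Sum>s\<in>S. Q (dX n s) n \<omega> / \<epsilon>\<^sup>2)"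
          by (rule member_le_sum[OF 3(1)]) (auto simp: nonneg S(1))
        then show ?thesis using ge1[OF 3(2) \<epsilon>(1)] by linarith
      next
        case 4
        have "Q (dY n t) n \<omega> / \<epsilon>\<^sup>2 \<le> (\<Sum>t\<in>S. Q (dY n t) n \<omega> / \<epsilon>\<^sup>2)"
          by (rule member_le_sum[OF 4(1)]) (auto simp: nonneg S(1))
        then show ?thesis using ge1[OF 4(2) \<epsilon>(1)] by linarith
      next
        case 5
        have "Q (dXY n s t) n \<omega> / \<epsilon>\<^sup>2 \<le> (\<Sum>t\<in>S. Q (dXY n s t) n \<omega> / \<epsilon>\<^sup>2)"
          by (rule member_le_sum[OF 5(2)]) (auto simp: nonneg S(1))
        also have "\<dots> \<le> (\<Sum>s\<in>S. \<Sum>t\<in>S. Q (dXY n s t) n \<omega> / \<epsilon>\<^sup>2)"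
          by (rule member_le_sum[OF 5(1)]) (auto simp: nonneg S(1) intro!: sum_nonneg)
        finally show ?thesis using ge1[OF 5(3) \<epsilon>(1)] by linarith
      qed (use ge1 \<open>T > 0\<close> in blast)+
      moreover have "0 \<le> (\<Sum>s\<in>S. Q (dX n s) n \<omega> / \<epsilon>\<^sup>2)" "0 \<le> (\<Sum>t\<in>S. Q (dY n t) n \<omega> / \<epsilon>\<^sup>2)"
        "0 \<le> (\<Sum>s\<in>S. \<Sum>t\<in>S. Q (dXY n s t) n \<omega> / \<epsilon>\<^sup>2)"
        by (intro sum_nonneg nonneg)+
      ultimately show ?thesis
        using nonneg[of "IX (qX \<alpha>)" T] nonneg[of "IY (qY \<alpha>)" T] unfolding rhs_def by linarith
    qed
    have mu_sq: "expectation (Q f n) \<le> mu (\<lambda>p. (f p)\<^sup>2)"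
      if "f \<in> borel_measurable borel" "\<And>p. \<bar>f p\<bar> \<le> b" for f b
      unfolding Q_def using that n by (rule emp_process_square_le)
    have EI: "expectation (Q (IX (qX \<alpha>)) n) \<le> 1" "expectation (Q (IY (qY \<alpha>)) n) \<le> 1"
    proof -
      have "(\<lambda>p. (IX s p)\<^sup>2) = IX s" "(\<lambda>p. (IY s p)\<^sup>2) = IY s" for s
        by (auto simp: fun_eq_iff IX_def IY_def indicator_def)
      then show "expectation (Q (IX (qX \<alpha>)) n) \<le> 1" "expectation (Q (IY (qY \<alpha>)) n) \<le> 1"
        using mu_sq[OF measurable_I(1) abs_I_le(1), of "qX \<alpha>"] mu_sq[OF measurable_I(2) abs_I_le(2), of "qY \<alpha>"]
          mu_I F_qX[OF \<alpha>] G_qY[OF \<alpha>] \<alpha> by auto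
    qed
    \<comment> \<open>The two quantile levels differ by \<open>s / sqrt n\<close>, which is the mass
      of the strip up to sign.\<close>
    have EdX: "expectation (Q (dX n s) n) \<le> \<bar>s\<bar> / sqrt (real n)" if "s \<in> S" for s
      using mu_sq[OF meas(1) bd(1), of n s] mu_IX_diff[of "qX (\<alpha> + s / sqrt (real n))" "qX \<alpha>"]
        F_qX[OF \<alpha>] F_qX[of "\<alpha> + s / sqrt (real n)"] range that by (simp add: dX_def)
    have EdY: "expectation (Q (dY n t) n) \<le> \<bar>t\<bar> / sqrt (real n)" if "t \<in> S" for t
      using mu_sq[OF meas(2) bd(2), of n t] mu_IY_diff[of "qY (\<alpha> + t / sqrt (real n))" "qY \<alpha>"]
        G_qY[OF \<alpha>] G_qY[of "\<alpha> + t / sqrt (real n)"] range that by (simp add: dY_def)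
    have EdXY: "expectation (Q (dXY n s t) n) \<le> (\<bar>s\<bar> + \<bar>t\<bar>) / sqrt (real n)" if "s \<in> S" "t \<in> S" for s t
    proof -
      have "expectation (Q (dXY n s t) n) \<le> mu (\<lambda>p. (dXY n s t p)\<^sup>2)"
        by (rule mu_sq[OF meas(3) bd(3)])
      also have "\<dots> \<le> \<bar>F (qX (\<alpha> + s / sqrt (real n))) - F (qX \<alpha>)\<bar>
          + \<bar>G (qY (\<alpha> + t / sqrt (real n))) - G (qY \<alpha>)\<bar>"
        unfolding dXY_def by (rule mu_IXY_diff)
      also have "\<dots> = (\<bar>s\<bar> + \<bar>t\<bar>) / sqrt (real n)"
        using F_qX[OF \<alpha>] F_qX[of "\<alpha> + s / sqrt (real n)"] G_qY[OF \<alpha>] G_qY[of "\<alpha> + t / sqrt (real n)"]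
          range that by (simp add: add_divide_distrib)
      finally show ?thesis .
    qed
    have "prob {\<omega> \<in> space M. \<bar>remainder n \<omega>\<bar> > \<kappa>}
      = expectation (indicator {\<omega> \<in> space M. \<bar>remainder n \<omega>\<bar> > \<kappa>})"
      by (simp add: Bochner_Integration.integral_indicator Int_absorb2 subset_eq)
    also have "\<dots> \<le> expectation (rhs n)"
    proof (rule integral_mono[OF _ int_rhs])
      show "integrable M (indicator {\<omega> \<in> space M. \<bar>remainder n \<omega>\<bar> > \<kappa>} :: 'a \<Rightarrow> real)"
        by (simp add: emeasure_eq_measure)
      show "indicator {\<omega> \<in> space M. \<bar>remainder n \<omega>\<bar> > \<kappa>} \<omega> \<le> rhs n \<omega>" for \<omega>
        using rhs_ge[of \<omega>] rhs_nonneg[of n \<omega>] by (simp add: indicator_def)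
    qed
    also have "\<dots> = expectation (Q (IX (qX \<alpha>)) n) / T\<^sup>2 + expectation (Q (IY (qY \<alpha>)) n) / T\<^sup>2
      + (\<Sum>s\<in>S. expectation (Q (dX n s) n) / \<epsilon>\<^sup>2) + (\<Sum>t\<in>S. expectation (Q (dY n t) n) / \<epsilon>\<^sup>2)
      + (\<Sum>s\<in>S. \<Sum>t\<in>S. expectation (Q (dXY n s t) n) / \<epsilon>\<^sup>2)"
      unfolding rhs_def
      by (simp add: int Bochner_Integration.integral_add Bochner_Integration.integral_sum
          Bochner_Integration.integrable_add Bochner_Integration.integrable_sum integrable_divide)
    also have "\<dots> \<le> 1 / T\<^sup>2 + 1 / T\<^sup>2 + (\<Sum>s\<in>S. (\<bar>s\<bar> / sqrt (real n)) / \<epsilon>\<^sup>2) + (\<Sum>t\<in>S. (\<bar>t\<bar> / sqrt (real n)) / \<epsilon>\<^sup>2)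
      + (\<Sum>s\<in>S. \<Sum>t\<in>S. ((\<bar>s\<bar> + \<bar>t\<bar>) / sqrt (real n)) / \<epsilon>\<^sup>2)"
      by (intro add_mono sum_mono divide_right_mono EI EdX EdY EdXY) auto
    also have "\<dots> = 2 / T\<^sup>2 + K / sqrt (real n)"
    proof -
      have two: "2 / T\<^sup>2 = 1 / T\<^sup>2 + 1 / T\<^sup>2" by simp
      show ?thesis
        unfolding two K_def add_divide_distrib sum_divide_distrib
        by (simp only: divide_divide_eq_left mult.commute[of "\<epsilon>\<^sup>2"] add.assoc)
    qed
    finally show ?thesis .
  qed
  \<comment> \<open>The deterministic hypotheses of \<open>remainder_le\<close> hold at each grid
    point for large \<open>n\<close>, hence for large \<open>n\<close> at all grid points at
    once.\<close>
  have ev_range: "\<forall>\<^sub>F n in sequentially. \<forall>s\<in>S. \<alpha> + s / sqrt (real n) \<in> {0<..<1}"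
  proof (rule eventually_ball_finite[OF S(1)], rule ballI)
    fix s
    have "(\<lambda>n. \<alpha> + s / sqrt (real n)) \<longlonglongrightarrow> \<alpha>" by real_asymp
    then show "\<forall>\<^sub>F n in sequentially. \<alpha> + s / sqrt (real n) \<in> {0<..<1}"
      using \<alpha> by (intro topological_tendstoD) auto
  qed
  have ev_taylor: "\<forall>\<^sub>F n in sequentially. \<forall>s\<in>S. \<forall>t\<in>S.
        \<bar>sqrt (real n) * (C (\<alpha> + s / sqrt (real n)) (\<alpha> + t / sqrt (real n)) - C \<alpha> \<alpha>)
          - (h1 C \<alpha> \<alpha> * s + h2 C \<alpha> \<alpha> * t)\<bar> < \<epsilon>"
  proof (intro eventually_ball_finite[OF S(1)] ballI)
    fix s t
    show "\<forall>\<^sub>F n in sequentially.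
        \<bar>sqrt (real n) * (C (\<alpha> + s / sqrt (real n)) (\<alpha> + t / sqrt (real n)) - C \<alpha> \<alpha>)
          - (h1 C \<alpha> \<alpha> * s + h2 C \<alpha> \<alpha> * t)\<bar> < \<epsilon>"
      using tendstoD[OF continuous_partials_sqrt_expansion[OF partials_C \<alpha> \<alpha>] \<epsilon>(1)]
      by (simp add: dist_real_def)
  qed
  have "\<forall>\<^sub>F n in sequentially.
    prob {\<omega> \<in> space M. \<bar>remainder n \<omega>\<bar> > \<kappa>} \<le> 2 / T\<^sup>2 + K / sqrt (real n)"
    using eventually_ge_at_top[of 1] ev_range ev_taylor by eventually_elim (rule main)
  then show ?thesis by (rule that)
qed

text \<open>First \<open>T\<close> is fixed, with \<open>2 / T^2 = e / 2\<close>, and only then does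
  \<open>n\<close> grow, so that the grid constant \<open>K\<close> is harmless.\<close>

lemma remainder_in_prob:
  assumes "\<kappa> > 0"
  shows "(\<lambda>n. prob {\<omega> \<in> space M. \<bar>remainder n \<omega>\<bar> > \<kappa>}) \<longlonglongrightarrow> 0"
proof (rule tendstoI)
  fix e :: real assume "e > 0"
  define T where "T = 2 / sqrt e"
  have T: "T > 0" "2 / T\<^sup>2 < e" using \<open>e > 0\<close> by (auto simp: T_def power_divide)
  obtain K where K: "\<forall>\<^sub>F n in sequentially.
      prob {\<omega> \<in> space M. \<bar>remainder n \<omega>\<bar> > \<kappa>} \<le> 2 / T\<^sup>2 + K / sqrt (real n)"
    using remainder_prob_bound[OF assms T(1)] .
  have "(\<lambda>n. 2 / T\<^sup>2 + K / sqrt (real n)) \<longlonglongrightarrow> 2 / T\<^sup>2" by real_asymp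
  then have "\<forall>\<^sub>F n in sequentially. 2 / T\<^sup>2 + K / sqrt (real n) < e"
    using T(2) by (rule order_tendstoD)
  with K show "\<forall>\<^sub>F n in sequentially. dist (prob {\<omega> \<in> space M. \<bar>remainder n \<omega>\<bar> > \<kappa>}) 0 < e"
    by eventually_elim (simp add: dist_real_def)
qed

section \<open>Fourth moments and mean-square convergence of the remainder\<close>

text \<open>The joint process cancels the empirical joint distribution function, leaving
  \<open>sqrt n\<close> times its distance from the empirical copula, plus
  \<open>h1 * A + h2 * B\<close>. The rank bound controls that distance outside the null event of
  ties, and its term \<open>2 / n\<close> becomes at most 2 after scaling.\<close>

lemma AE_abs_remainder_le:
  assumes n: "n \<ge> 1"
  shows "AE \<omega> in M. \<bar>remainder n \<omega>\<bar> \<le> (1 + \<bar>h1 C \<alpha> \<alpha>\<bar>) * \<bar>emp_process n (IX (qX \<alpha>)) \<omega>\<bar>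
    + ((1 + \<bar>h2 C \<alpha> \<alpha>\<bar>) * \<bar>emp_process n (IY (qY \<alpha>)) \<omega>\<bar> + 2)"
  using AE_inj_on[of n]
proof eventually_elim
  case (elim \<omega>)
  define x y where "x = (\<lambda>j. X j \<omega>)" and "y = (\<lambda>j. Y j \<omega>)"
  define A B where "A = emp_process n (IX (qX \<alpha>)) \<omega>" and "B = emp_process n (IY (qY \<alpha>)) \<omega>"
  define w where "w = sqrt (real n)"
  have w: "w \<ge> 1" using n by (simp add: w_def)
  let ?H = "emp_joint_cdf n x y (qX \<alpha>) (qY \<alpha>)"
  have AB: "A = w * (emp_cdf n x (qX \<alpha>) - \<alpha>)" "B = w * (emp_cdf n y (qY \<alpha>) - \<alpha>)"
    "emp_process n (IXY (qX \<alpha>) (qY \<alpha>)) \<omega> = w * (?H - C \<alpha> \<alpha>)"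
    using emp_process_I[OF n] F_qX[OF \<alpha>] G_qY[OF \<alpha>] by (simp_all add: A_def B_def w_def x_def y_def)
  have "w * \<bar>emp_copula n x y \<alpha> \<alpha> - ?H\<bar>
    \<le> w * (\<bar>emp_cdf n x (qX \<alpha>) - \<alpha>\<bar> + \<bar>emp_cdf n y (qY \<alpha>) - \<alpha>\<bar> + 2 / real n)"
    using elim \<alpha> n w by (intro mult_left_mono emp_copula_vs_emp_joint_cdf) (auto simp: x_def y_def)
  also have "\<dots> = \<bar>A\<bar> + \<bar>B\<bar> + 2 * (w / real n)"
    using w by (simp add: AB abs_mult distrib_left)
  also have "w / real n = 1 / w"
    using n by (simp add: w_def field_simps)
  also have "2 * (1 / w) \<le> 2" using w by (simp add: field_simps)
  finally have 1: "\<bar>w * (emp_copula n x y \<alpha> \<alpha> - ?H)\<bar> \<le> \<bar>A\<bar> + \<bar>B\<bar> + 2"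
    using w by (simp add: abs_mult)
  have "remainder n \<omega> = w * (emp_copula n x y \<alpha> \<alpha> - ?H) + h1 C \<alpha> \<alpha> * A + h2 C \<alpha> \<alpha> * B"
    unfolding remainder_def AB(3) by (simp add: A_def B_def w_def x_def y_def algebra_simps)
  then have "\<bar>remainder n \<omega>\<bar> \<le> (\<bar>A\<bar> + \<bar>B\<bar> + 2) + \<bar>h1 C \<alpha> \<alpha>\<bar> * \<bar>A\<bar> + \<bar>h2 C \<alpha> \<alpha>\<bar> * \<bar>B\<bar>"
    using 1 by (simp flip: abs_mult)
  then show ?case by (simp add: A_def B_def algebra_simps)
qed

lemma remainder_0: "remainder 0 \<omega> = 0"
  by (simp add: remainder_def emp_process_def)

text \<open>The fourth power of the preceding bound, split twice by \<open>power4_add_le\<close>: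
  this gives 8, then \<open>64 = 8 * 8\<close> and \<open>1024 = 8 * 8 * 2^4\<close>. The factor 48
  bounds the fourth moments of the marginal processes.\<close>

lemma remainder_fourth_moment:
  shows "integrable M (\<lambda>\<omega>. remainder n \<omega> ^ 4)"
    and "n \<ge> 1 \<Longrightarrow> expectation (\<lambda>\<omega>. remainder n \<omega> ^ 4)
      \<le> 8 * (1 + \<bar>h1 C \<alpha> \<alpha>\<bar>) ^ 4 * 48 + (64 * (1 + \<bar>h2 C \<alpha> \<alpha>\<bar>) ^ 4 * 48 + 1024)"
proof -
  define a b where "a = 1 + \<bar>h1 C \<alpha> \<alpha>\<bar>" and "b = 1 + \<bar>h2 C \<alpha> \<alpha>\<bar>"
  let ?A = "emp_process n (IX (qX \<alpha>))" and ?B = "emp_process n (IY (qY \<alpha>))"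
  let ?rhs = "\<lambda>\<omega>. 8 * a ^ 4 * ?A \<omega> ^ 4 + (64 * b ^ 4 * ?B \<omega> ^ 4 + 1024)"
  have int: "integrable M (\<lambda>\<omega>. ?A \<omega> ^ 4)" "integrable M (\<lambda>\<omega>. ?B \<omega> ^ 4)"
    by (rule integrable_emp_process_power[OF measurable_I(1) abs_I_le(1)]
        integrable_emp_process_power[OF measurable_I(2) abs_I_le(2)])+
  then have int_rhs: "integrable M ?rhs" by simp
  have le: "AE \<omega> in M. remainder n \<omega> ^ 4 \<le> ?rhs \<omega>" if "n \<ge> 1"
    using AE_abs_remainder_le[OF that]
  proof eventually_elim
    case (elim \<omega>)
    have "remainder n \<omega> ^ 4 = \<bar>remainder n \<omega>\<bar> ^ 4" by simp
    also have "\<dots> \<le> (a * \<bar>?A \<omega>\<bar> + (b * \<bar>?B \<omega>\<bar> + 2)) ^ 4"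
      using elim unfolding a_def b_def by (intro power_mono) auto
    also have "\<dots> \<le> 8 * (a * \<bar>?A \<omega>\<bar>) ^ 4 + 8 * (b * \<bar>?B \<omega>\<bar> + 2) ^ 4"
      by (rule power4_add_le)
    also have "\<dots> \<le> 8 * (a * \<bar>?A \<omega>\<bar>) ^ 4 + 8 * (8 * (b * \<bar>?B \<omega>\<bar>) ^ 4 + 8 * 2 ^ 4)"
      by (intro add_left_mono mult_left_mono power4_add_le) auto
    also have "\<dots> = ?rhs \<omega>" by (simp add: power_mult_distrib)
    finally show ?case .
  qed
  show int4: "integrable M (\<lambda>\<omega>. remainder n \<omega> ^ 4)"
  proof (cases "n \<ge> 1")
    case True
    show ?thesis
    proof (rule Bochner_Integration.integrable_bound[OF int_rhs])
      show "AE \<omega> in M. norm (remainder n \<omega> ^ 4) \<le> norm (?rhs \<omega>)"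
        using le[OF True] by eventually_elim (simp add: order_trans[OF _ abs_ge_self])
    qed measurable
  next
    case False
    then have "n = 0" by simp
    then show ?thesis by (simp add: remainder_0)
  qed
  assume "n \<ge> 1"
  have "expectation (\<lambda>\<omega>. remainder n \<omega> ^ 4) \<le> expectation ?rhs"
    by (rule integral_mono_AE[OF int4 int_rhs le[OF \<open>n \<ge> 1\<close>]])
  also have "\<dots> = 8 * a ^ 4 * expectation (\<lambda>\<omega>. ?A \<omega> ^ 4) + (64 * b ^ 4 * expectation (\<lambda>\<omega>. ?B \<omega> ^ 4) + 1024)"
    using int by (simp add: prob_space)
  also have "\<dots> \<le> 8 * a ^ 4 * 48 + (64 * b ^ 4 * 48 + 1024)"
    using emp_process_moments(3)[OF measurable_I(1) abs_I_le(1), of n "qX \<alpha>"]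
      emp_process_moments(3)[OF measurable_I(2) abs_I_le(2), of n "qY \<alpha>"]
    by (intro add_mono mult_left_mono) auto
  finally show "expectation (\<lambda>\<omega>. remainder n \<omega> ^ 4) \<le> 8 * (1 + \<bar>h1 C \<alpha> \<alpha>\<bar>) ^ 4 * 48
      + (64 * (1 + \<bar>h2 C \<alpha> \<alpha>\<bar>) ^ 4 * 48 + 1024)"
    by (simp add: a_def b_def)
qed

lemma remainder_L2: "(\<lambda>n. expectation (\<lambda>\<omega>. (remainder n \<omega>)\<^sup>2)) \<longlonglongrightarrow> 0"
  using remainder_fourth_moment remainder_in_prob
  by (intro square_expectation_tendsto_0) auto

section \<open>The linear part and its variance\<close>

text \<open>The influence function of the empirical copula at \<open>(\<alpha>, \<alpha>)\<close>:
  its empirical process is the linear part \<open>D - h1 * A - h2 * B\<close> of the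
  overview.\<close>

definition influence :: "real \<times> real \<Rightarrow> real" where
  "influence p = IXY (qX \<alpha>) (qY \<alpha>) p - h1 C \<alpha> \<alpha> * IX (qX \<alpha>) p - h2 C \<alpha> \<alpha> * IY (qY \<alpha>) p"

lemma measurable_influence [measurable]: "influence \<in> borel_measurable borel"
  unfolding influence_def[abs_def] by measurable

lemma abs_influence_le: "\<bar>influence p\<bar> \<le> 1 + \<bar>h1 C \<alpha> \<alpha>\<bar> + \<bar>h2 C \<alpha> \<alpha>\<bar>"
  by (auto simp: influence_def IXY_def IX_def IY_def indicator_def)

text \<open>Indicators are idempotent and every mixed product of the three is \<open>IXY\<close>, so
  the square of \<open>influence\<close> is again a linear combination of them and its mean can be
  read off.\<close>

lemma variance_influence:
  "mu (\<lambda>p. (influence p)\<^sup>2) - (mu influence)\<^sup>2 = sigma_sq C \<alpha>"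
proof -
  define a b where "a = h1 C \<alpha> \<alpha>" and "b = h2 C \<alpha> \<alpha>"
  have int: "integrable M (\<lambda>\<omega>. IX s (X 1 \<omega>, Y 1 \<omega>))" "integrable M (\<lambda>\<omega>. IY s (X 1 \<omega>, Y 1 \<omega>))"
    "integrable M (\<lambda>\<omega>. IXY s t (X 1 \<omega>, Y 1 \<omega>))" for s t
    by (rule integrable_P[of _ 1 1]; simp add: abs_I_le)+
  have lin: "mu (\<lambda>p. c * IXY s t p + d * IX s p + e * IY t p) = c * C (F s) (G t) + d * F s + e * G t"
    for c d e s t
  proof -
    have "mu (\<lambda>p. c * IXY s t p + d * IX s p + e * IY t p) = c * mu (IXY s t) + d * mu (IX s) + e * mu (IY t)"
      unfolding mu_def using int by simp
    then show ?thesis by (simp only: mu_I)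
  qed
  have "influence = (\<lambda>p. 1 * IXY (qX \<alpha>) (qY \<alpha>) p + (- a) * IX (qX \<alpha>) p + (- b) * IY (qY \<alpha>) p)"
    by (simp add: influence_def a_def b_def fun_eq_iff)
  then have m: "mu influence = C \<alpha> \<alpha> - a * \<alpha> - b * \<alpha>"
    using lin[of 1 "qX \<alpha>" "qY \<alpha>" "- a" "- b"] F_qX[OF \<alpha>] G_qY[OF \<alpha>] by simp
  have "(influence p)\<^sup>2 = (1 - 2 * a - 2 * b + 2 * a * b) * IXY (qX \<alpha>) (qY \<alpha>) p
      + a\<^sup>2 * IX (qX \<alpha>) p + b\<^sup>2 * IY (qY \<alpha>) p" for p
    unfolding influence_def IXY_def a_def[symmetric] b_def[symmetric]
    by (cases "fst p \<le> qX \<alpha>"; cases "snd p \<le> qY \<alpha>")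
      (simp_all add: IX_def IY_def power2_eq_square algebra_simps)
  then have "mu (\<lambda>p. (influence p)\<^sup>2) = (1 - 2 * a - 2 * b + 2 * a * b) * C \<alpha> \<alpha> + a\<^sup>2 * \<alpha> + b\<^sup>2 * \<alpha>"
    using lin F_qX[OF \<alpha>] G_qY[OF \<alpha>] by simp
  then show "mu (\<lambda>p. (influence p)\<^sup>2) - (mu influence)\<^sup>2 = sigma_sq C \<alpha>"
    unfolding m sigma_sq_def diag_section_def Let_def a_def[symmetric] b_def[symmetric]
    by (simp add: power2_eq_square algebra_simps)
qed

section \<open>Bias, variance and mean squared error of the estimator\<close>

lemma ltd_estimator_expansion:
  assumes "n \<ge> 1"
  shows "ltd_estimator n X Y \<alpha> \<omega> = C \<alpha> \<alpha> / \<alpha>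
    + (emp_process n influence \<omega> + remainder n \<omega>) / (sqrt (real n) * \<alpha>)"
proof -
  have "emp_process n influence \<omega> = emp_process n (IXY (qX \<alpha>) (qY \<alpha>)) \<omega>
    - h1 C \<alpha> \<alpha> * emp_process n (IX (qX \<alpha>)) \<omega> - h2 C \<alpha> \<alpha> * emp_process n (IY (qY \<alpha>)) \<omega>"
  proof -
    have "\<bar>c * IX s p\<bar> \<le> \<bar>c\<bar>" "\<bar>c * IY s p\<bar> \<le> \<bar>c\<bar>" "\<bar>IXY s t p - c * IX s p\<bar> \<le> 1 + \<bar>c\<bar>" for c s t p
      by (auto simp: IX_def IY_def IXY_def indicator_def)
    note b = this
    have "emp_process n influence \<omega>
      = emp_process n (\<lambda>p. IXY (qX \<alpha>) (qY \<alpha>) p - h1 C \<alpha> \<alpha> * IX (qX \<alpha>) p) \<omega>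
        - emp_process n (\<lambda>p. h2 C \<alpha> \<alpha> * IY (qY \<alpha>) p) \<omega>"
      unfolding influence_def[abs_def] by (rule emp_process_diff[OF _ b(3) _ b(2)]) measurable
    also have "emp_process n (\<lambda>p. IXY (qX \<alpha>) (qY \<alpha>) p - h1 C \<alpha> \<alpha> * IX (qX \<alpha>) p) \<omega>
      = emp_process n (IXY (qX \<alpha>) (qY \<alpha>)) \<omega> - emp_process n (\<lambda>p. h1 C \<alpha> \<alpha> * IX (qX \<alpha>) p) \<omega>"
      by (rule emp_process_diff[OF _ abs_I_le(3) _ b(1)]) measurable
    finally show ?thesis by (simp only: emp_process_cmult)
  qed
  then have "emp_process n influence \<omega> + remainder n \<omega>
    = sqrt (real n) * (emp_copula n (\<lambda>j. X j \<omega>) (\<lambda>j. Y j \<omega>) \<alpha> \<alpha> - C \<alpha> \<alpha>)"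
    by (simp add: remainder_def)
  then have "(emp_process n influence \<omega> + remainder n \<omega>) / (sqrt (real n) * \<alpha>)
    = (emp_copula n (\<lambda>j. X j \<omega>) (\<lambda>j. Y j \<omega>) \<alpha> \<alpha> - C \<alpha> \<alpha>) / \<alpha>"
    using assms by simp
  then show ?thesis
    by (simp add: ltd_estimator_def ltd_estimate_def diff_divide_distrib)
qed

text \<open>The linear part is centred, so the mean of the remainder alone makes up the bias about
  \<open>C \<alpha> \<alpha> / \<alpha>\<close>. For the variance, the remainder is a perturbation
  that is negligible in mean square.\<close>

lemma ltd_estimator_asymptotics:
  shows "(\<lambda>n. sqrt (real n) * (expectation (ltd_estimator n X Y \<alpha>) - C \<alpha> \<alpha> / \<alpha>)) \<longlonglongrightarrow> 0"
    and "(\<lambda>n. real n * variance (ltd_estimator n X Y \<alpha>)) \<longlonglongrightarrow> sigma_sq C \<alpha> / \<alpha>\<^sup>2"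
proof -
  let ?Z = "\<lambda>n. emp_process n influence"
  have R2: "integrable M (\<lambda>\<omega>. (remainder n \<omega>)\<^sup>2)" for n
    using expectation_mult_square_le(1)[of "\<lambda>\<omega>. (remainder n \<omega>)\<^sup>2" "\<lambda>_. 1"] remainder_fourth_moment(1)[of n]
    by (simp flip: power_mult)
  then have R1: "integrable M (remainder n)" for n
    using expectation_mult_square_le(1)[of "remainder n" "\<lambda>_. 1"] by simp
  note mom = emp_process_moments[OF measurable_influence abs_influence_le]
  note intZ = integrable_emp_process_power[OF measurable_influence abs_influence_le]
  have Z1: "integrable M (?Z n)" for n using intZ[of n 1] by simp
  have Z2: "n \<ge> 1 \<Longrightarrow> expectation (\<lambda>\<omega>. (?Z n \<omega>)\<^sup>2) = sigma_sq C \<alpha>" for n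
    using mom(2)[of n] variance_influence by simp
  have "(\<lambda>n. expectation (remainder n)) \<longlonglongrightarrow> 0"
    and var: "(\<lambda>n. variance (\<lambda>\<omega>. ?Z n \<omega> + remainder n \<omega>)) \<longlonglongrightarrow> sigma_sq C \<alpha>"
    using variance_perturbation_tendsto[OF _ _ intZ R2 mom(1) Z2 remainder_L2] by auto
  then have lim: "(\<lambda>n. expectation (remainder n) / \<alpha>) \<longlonglongrightarrow> 0"
    using tendsto_divide_zero by blast
  have E: "expectation (ltd_estimator n X Y \<alpha>) = C \<alpha> \<alpha> / \<alpha> + expectation (remainder n) / (sqrt (real n) * \<alpha>)"
    if "n \<ge> 1" for n
    unfolding ltd_estimator_expansion[OF that, abs_def] using Z1 R1 mom(1)[of n] by (simp add: prob_space)
  have V: "real n * variance (ltd_estimator n X Y \<alpha>) = variance (\<lambda>\<omega>. ?Z n \<omega> + remainder n \<omega>) / \<alpha>\<^sup>2"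
    if "n \<ge> 1" for n
  proof -
    have "ltd_estimator n X Y \<alpha> \<omega> - expectation (ltd_estimator n X Y \<alpha>)
      = (?Z n \<omega> + remainder n \<omega> - expectation (\<lambda>\<omega>. ?Z n \<omega> + remainder n \<omega>)) / (sqrt (real n) * \<alpha>)" for \<omega>
      unfolding E[OF that] ltd_estimator_expansion[OF that] using Z1 R1 mom(1)[of n]
      by (simp add: diff_divide_distrib add_divide_distrib)
    then have "variance (ltd_estimator n X Y \<alpha>)
      = variance (\<lambda>\<omega>. ?Z n \<omega> + remainder n \<omega>) / (sqrt (real n) * \<alpha>)\<^sup>2"
      by (simp only: power_divide integral_divide_zero)
    then show ?thesis using that by (simp add: power_mult_distrib)
  qed
  show "(\<lambda>n. sqrt (real n) * (expectation (ltd_estimator n X Y \<alpha>) - C \<alpha> \<alpha> / \<alpha>)) \<longlonglongrightarrow> 0"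
    using lim
  proof (rule Lim_transform_eventually)
    show "\<forall>\<^sub>F n in sequentially. expectation (remainder n) / \<alpha>
      = sqrt (real n) * (expectation (ltd_estimator n X Y \<alpha>) - C \<alpha> \<alpha> / \<alpha>)"
      using eventually_ge_at_top[of 1] by eventually_elim (simp add: E)
  qed
  have "(\<lambda>n. variance (\<lambda>\<omega>. ?Z n \<omega> + remainder n \<omega>) / \<alpha>\<^sup>2) \<longlonglongrightarrow> sigma_sq C \<alpha> / \<alpha>\<^sup>2"
    using \<alpha> by (intro tendsto_divide var tendsto_const) auto
  then show "(\<lambda>n. real n * variance (ltd_estimator n X Y \<alpha>)) \<longlonglongrightarrow> sigma_sq C \<alpha> / \<alpha>\<^sup>2"
  proof (rule Lim_transform_eventually)
    show "\<forall>\<^sub>F n in sequentially. variance (\<lambda>\<omega>. ?Z n \<omega> + remainder n \<omega>) / \<alpha>\<^sup>2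
      = real n * variance (ltd_estimator n X Y \<alpha>)"
      using eventually_ge_at_top[of 1] by eventually_elim (simp add: V)
  qed
qed

text \<open>The bias-variance decomposition about an arbitrary centre \<open>l\<close>. The
  estimator is bounded by \<open>1 / \<alpha>\<close>, which supplies integrability.\<close>

lemma ltd_estimator_mse:
  "expectation (\<lambda>\<omega>. (ltd_estimator n X Y \<alpha> \<omega> - l)\<^sup>2)
    = variance (ltd_estimator n X Y \<alpha>) + (expectation (ltd_estimator n X Y \<alpha>) - l)\<^sup>2"
proof -
  let ?T = "ltd_estimator n X Y \<alpha>"
  have [measurable]: "?T \<in> borel_measurable M"
    unfolding ltd_estimator_def[abs_def] ltd_estimate_def by measurable
  have "\<bar>emp_copula n x y \<alpha> \<alpha>\<bar> \<le> 1" for x y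
  proof -
    have "\<bar>\<Sum>j=1..n. of_bool (emp_cdf n x (x j) \<le> \<alpha>) * of_bool (emp_cdf n y (y j) \<le> \<alpha>) :: real\<bar>
      \<le> real (card {1..n}) * 1"
      by (rule order_trans[OF sum_abs sum_bounded_above]) auto
    then show ?thesis by (cases "n = 0") (simp_all add: emp_copula_def)
  qed
  then have "\<bar>?T \<omega>\<bar> \<le> 1 / \<alpha>" for \<omega>
    using \<alpha> by (simp add: ltd_estimator_def ltd_estimate_def divide_right_mono)
  note b = this
  have "(?T \<omega>)\<^sup>2 \<le> (1 / \<alpha>)\<^sup>2" for \<omega>
    using power_mono[OF b[of \<omega>], of 2] by simp
  then have int: "integrable M ?T" "integrable M (\<lambda>\<omega>. (?T \<omega>)\<^sup>2)"
    using b by (intro integrable_const_bound[of ?T "1 / \<alpha>"]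
      integrable_const_bound[of "\<lambda>\<omega>. (?T \<omega>)\<^sup>2" "(1 / \<alpha>)\<^sup>2"]; simp)+
  have "(\<lambda>\<omega>. (?T \<omega> - l)\<^sup>2) = (\<lambda>\<omega>. (?T \<omega>)\<^sup>2 - 2 * l * ?T \<omega> + l\<^sup>2)"
    by (simp add: power2_diff fun_eq_iff algebra_simps)
  then have "expectation (\<lambda>\<omega>. (?T \<omega> - l)\<^sup>2) = expectation (\<lambda>\<omega>. (?T \<omega>)\<^sup>2) - 2 * l * expectation ?T + l\<^sup>2"
    using int by (simp add: prob_space)
  then show ?thesis
    using variance_eq[OF int] by (simp add: power2_diff algebra_simps)
qed

end

text \<open>The term \<open>V\<close> is taken to be the variance of the estimator, and
  \<open>r n\<close> is the bias of the estimator about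
  \<open>C \<alpha> \<alpha> / \<alpha>\<close>. It stays inside the square so that the identity is
  exact for each \<open>n \<ge> 1\<close>: its cross term with the limiting bias is bounded here
  only by \<open>o(1 / sqrt n)\<close>, which is too weak to be absorbed into \<open>V\<close> at
  the scale \<open>1 / n\<close>.\<close>

theorem theorem1:
  fixes M :: "'a measure"
    and X Y :: "nat \<Rightarrow> 'a \<Rightarrow> real"
    and C :: "real \<Rightarrow> real \<Rightarrow> real"
    and \<alpha> :: real
  assumes "prob_space M"
    and "prob_space.indep_vars M (\<lambda>_. borel) (\<lambda>j \<omega>. (X j \<omega>, Y j \<omega>)) {1..}"
    and "\<And>j. j \<ge> 1 \<Longrightarrow>
           distr M borel (\<lambda>\<omega>. (X j \<omega>, Y j \<omega>)) = distr M borel (\<lambda>\<omega>. (X 1 \<omega>, Y 1 \<omega>))"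
    and "continuous_on UNIV (cdf (distr M borel (X 1)))"
    and "continuous_on UNIV (cdf (distr M borel (Y 1)))"
    and "copula_of M (X 1) (Y 1) C"
    and "continuous_partials C"
    and "\<exists>l. ((\<lambda>u. C u u / u) \<longlongrightarrow> l) (at_right 0)"
    and "\<alpha> \<in> {0<..<1}"
  shows "(\<exists>r. r \<in> o(\<lambda>n. 1 / sqrt (real n)) \<and>
        (\<forall>n\<ge>1. prob_space.expectation M (\<lambda>\<omega>. (ltd_estimator n X Y \<alpha> \<omega> - lower_tail_dep C)\<^sup>2)
           = prob_space.variance M (ltd_estimator n X Y \<alpha>)
             + (diag_section C \<alpha> / \<alpha> - diag_deriv0 C + r n)\<^sup>2)) \<and>
      (\<lambda>n. real n * prob_space.variance M (ltd_estimator n X Y \<alpha>))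
        \<longlonglongrightarrow> sigma_sq C \<alpha> / \<alpha>\<^sup>2"
proof -
  interpret prob_space M by fact
  interpret copula_sample M X Y C \<alpha>
    by unfold_locales (fact assms)+
  obtain c where "((\<lambda>u. C u u / u) \<longlongrightarrow> c) (at_right 0)" using assms(8) by blast
  moreover have "copula C" using assms(6) by (simp add: copula_of_def)
  ultimately have l: "lower_tail_dep C = diag_deriv0 C"
    using copula_lower_tail_dep[of C c] by simp
  define r where "r = (\<lambda>n. expectation (ltd_estimator n X Y \<alpha>) - C \<alpha> \<alpha> / \<alpha>)"
  have "(\<lambda>n. sqrt (real n) * r n) \<longlonglongrightarrow> 0"
    unfolding r_def by (rule ltd_estimator_asymptotics(1))
  moreover have "r n / (1 / sqrt (real n)) = sqrt (real n) * r n" for n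
    by simp
  ultimately have lim: "(\<lambda>n. r n / (1 / sqrt (real n))) \<longlonglongrightarrow> 0"
    by presburger
  have r: "r \<in> o(\<lambda>n. 1 / sqrt (real n))"
  proof (rule smalloI_tendsto[OF lim])
    show "\<forall>\<^sub>F n in sequentially. 1 / sqrt (real n) \<noteq> 0"
      using eventually_gt_at_top[of 0] by eventually_elim simp
  qed
  have mse: "expectation (\<lambda>\<omega>. (ltd_estimator n X Y \<alpha> \<omega> - lower_tail_dep C)\<^sup>2)
    = variance (ltd_estimator n X Y \<alpha>) + (diag_section C \<alpha> / \<alpha> - diag_deriv0 C + r n)\<^sup>2" for n
  proof -
    have eq: "diag_section C \<alpha> / \<alpha> - diag_deriv0 C + r n = expectation (ltd_estimator n X Y \<alpha>) - lower_tail_dep C"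
      by (simp add: r_def diag_section_def l)
    show ?thesis unfolding eq by (rule ltd_estimator_mse)
  qed
  show ?thesis
    by (intro conjI exI[of _ r] allI impI r mse ltd_estimator_asymptotics(2))
qed

end
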